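(* Let $\eta>-1$, let $L_a^2(dA_\eta)$ be the standard weighted Bergman space on the unit disk $\mathbb{D}$, let $L$ be a bounded linear operator on $L_a^2(dA_\eta)$, and let $\{\lambda_n\}_{n=1}^{\infty}\subset \mathbb{D}$ be a sequence of distinct points. Put $k_{\lambda}^{\eta}(z)=\frac{(1-|\lambda|^2)^{1+\frac{\eta}{2}}}{(1-\overline{\lambda}z)^{2+\eta}}$ for $\lambda,z\in\mathbb{D}$. The following are equivalent: (i) $\{k_{\lambda_n}^{\eta}\}_{n=1}^{\infty}$ is an atomic system for $L$, i.e. the series $\sum_{n=1}^{\infty} c_n\frac{(1-|\lambda_n|^2)^{1+\frac{\eta}{2}}}{(1-\overline{\lambda_n}z)^{2+\eta}}$ converges in $L_a^2(dA_{\eta})$ for all $\{c_n\}\in l^2$, and there exists $C>0$ such that for every $f\in L_a^2(dA_\eta)$ there exists $a_f=(a_n)\in l^2$ with $\|a_f\|_{l^2}\leq C\|f\|$ and $Lf(z)=\sum_{n=1}^{\infty} a_n\frac{(1-|\lambda_n|^2)^{1+\frac{\eta}{2}}}{(1-\overline{\lambda_n}z)^{2+\eta}}$; (ii) $\{\lambda_n\}_{n=1}^{\infty}$ is a sampling sequence for $L$, i.e. there exist constants $A,B>0$ such that $$A\|L^*f\|^2\leq\sum_{n=1}^{\infty}|f(\lambda_n)|^2(1-|\lambda_n|^2)^{2+\eta}\leq B\|f\|^2\quad\text{for all } f\in L_a^2(dA_\eta);$$ (iii) $\{k_{\lambda_n}^{\eta}\}_{n=1}^{\infty}$ is a Bessel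 sequence and there exists a Bessel sequence $\{g_n\}_{n=1}^{\infty}\subset L_a^2(dA_\eta)$ such that $$Lf(z)=\sum_{n=1}^{\infty}\langle f,g_n\rangle \frac{(1-|\lambda_n|^2)^{1+\frac{\eta}{2}}}{(1-\overline{\lambda_n}z)^{2+\eta}}\quad\text{for all } f\in L_a^2(dA_\eta);$$ (iv) $\sum_{n=1}^{\infty}(1-|\lambda_n|^2)^{2+\eta}|f(\lambda_n)|^2<\infty$ for all $f\in L_a^2(dA_\eta)$, and there exists a Bessel sequence $\{g_n\}_{n=1}^{\infty}\subset L_a^2(dA_\eta)$ such that $$L^*f=\sum_{n=1}^{\infty}(1-|\lambda_n|^2)^{1+\frac{\eta}{2}}f(\lambda_n)g_n\quad\text{for all } f\in L_a^2(dA_\eta).$$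
   Context: $\mathbb{D}=\{z\in\mathbb{C}:|z|<1\}$, $dA(z)=\frac{1}{\pi}dx\,dy$ is normalized area measure on $\mathbb{D}$, and for $\eta>-1$, $dA_{\eta}(z)=(\eta+1)(1-|z|^2)^{\eta}dA(z)$. The standard weighted Bergman space $L_a^2(dA_{\eta})$ is the Hilbert space of analytic functions $f$ on $\mathbb{D}$ with $\|f\|^2=\int_{\mathbb{D}}|f(z)|^2dA_{\eta}(z)<\infty$, with inner product $\langle f,g\rangle=\int_{\mathbb{D}}f\overline{g}\,dA_\eta$. It is a reproducing kernel Hilbert space with kernel $K_{\lambda}^{\eta}(z)=\frac{1}{(1-\overline{\lambda}z)^{2+\eta}}$ (principal branch), i.e. $f(\lambda)=\langle f,K^\eta_\lambda\rangle$, and $k_\lambda^\eta=K_\lambda^\eta/\|K_\lambda^\eta\|$ is its normalized kernel. $L^*$ is the Hilbert space adjoint of $L$. Series of functions (including those written pointwise in $z$) converge in the norm of the space. A sequence $\{f_n\}_{n=1}^{\infty}$ in a Hilbert space $\mathcal{H}$ is a Bessel sequence if there is a constant $B>0$ such that $\sum_{n=1}^{\infty}|\langle x,f_n\rangle|^2\leq B\|x\|^2$ for all $x\in\mathcal{H}$. *)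

theory Defs
  imports "HOL-Complex_Analysis.Complex_Analysis"
begin

abbreviation unit_disk :: "complex set" where
  "unit_disk \<equiv> ball 0 1"

definition disk_area :: "complex measure" where
  "disk_area = density lborel (\<lambda>z. ennreal (indicator unit_disk z / pi))"

definition disk_area_weighted :: "real \<Rightarrow> complex measure" where
  "disk_area_weighted \<eta> =
     density disk_area (\<lambda>z. ennreal ((\<eta> + 1) * (1 - (cmod z)\<^sup>2) powr \<eta>))"

text \<open>
  Functions on the disk are represented by total functions that vanish outside the disk, so that
  equality of elements is equality of functions.
\<close>

definition bergman_space :: "real \<Rightarrow> (complex \<Rightarrow> complex) set" where
  "bergman_space \<eta> =
     {f. f holomorphic_on unit_disk \<and> (\<forall>z. z \<notin> unit_disk \<longrightarrow> f z = 0) \<and>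
         integrable (disk_area_weighted \<eta>) (\<lambda>z. (cmod (f z))\<^sup>2)}"

definition bergman_inner ::
    "real \<Rightarrow> (complex \<Rightarrow> complex) \<Rightarrow> (complex \<Rightarrow> complex) \<Rightarrow> complex" where
  "bergman_inner \<eta> f g = (LINT z|disk_area_weighted \<eta>. f z * cnj (g z))"

definition bergman_norm :: "real \<Rightarrow> (complex \<Rightarrow> complex) \<Rightarrow> real" where
  "bergman_norm \<eta> f = sqrt (LINT z|disk_area_weighted \<eta>. (cmod (f z))\<^sup>2)"

text \<open>Convergence of a series in the norm of the space, along the ordinary partial sums.\<close>

definition bergman_sums ::
    "real \<Rightarrow> (nat \<Rightarrow> complex \<Rightarrow> complex) \<Rightarrow> (complex \<Rightarrow> complex) \<Rightarrow> bool" where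
  "bergman_sums \<eta> u f \<longleftrightarrow>
     (\<forall>n. u n \<in> bergman_space \<eta>) \<and> f \<in> bergman_space \<eta> \<and>
     (\<lambda>N. bergman_norm \<eta> (\<lambda>z. (\<Sum>n<N. u n z) - f z)) \<longlonglongrightarrow> 0"

definition bounded_operator ::
    "real \<Rightarrow> ((complex \<Rightarrow> complex) \<Rightarrow> (complex \<Rightarrow> complex)) \<Rightarrow> bool" where
  "bounded_operator \<eta> L \<longleftrightarrow>
     (\<forall>f\<in>bergman_space \<eta>. L f \<in> bergman_space \<eta>) \<and>
     (\<forall>f\<in>bergman_space \<eta>. \<forall>g\<in>bergman_space \<eta>. L (\<lambda>z. f z + g z) = (\<lambda>z. L f z + L g z)) \<and>
     (\<forall>c. \<forall>f\<in>bergman_space \<eta>. L (\<lambda>z. c * f z) = (\<lambda>z. c * L f z)) \<and>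
     (\<exists>C. \<forall>f\<in>bergman_space \<eta>. bergman_norm \<eta> (L f) \<le> C * bergman_norm \<eta> f)"

text \<open>
  The Hilbert space adjoint. The description is meaningful for a bounded operator: the
  representing element exists by the Riesz representation theorem and is unique.
\<close>

definition bergman_adjoint ::
    "real \<Rightarrow> ((complex \<Rightarrow> complex) \<Rightarrow> (complex \<Rightarrow> complex)) \<Rightarrow> (complex \<Rightarrow> complex) \<Rightarrow> (complex \<Rightarrow> complex)"
  where
  "bergman_adjoint \<eta> L g =
     (THE h. h \<in> bergman_space \<eta> \<and>
        (\<forall>f\<in>bergman_space \<eta>. bergman_inner \<eta> (L f) g = bergman_inner \<eta> f h))"

text \<open>The complex power is the principal branch.\<close>

definition normalized_kernel :: "real \<Rightarrow> complex \<Rightarrow> complex \<Rightarrow> complex" where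
  "normalized_kernel \<eta> w z =
     (if z \<in> unit_disk
      then complex_of_real ((1 - (cmod w)\<^sup>2) powr (1 + \<eta> / 2)) /
           (1 - cnj w * z) powr complex_of_real (2 + \<eta>)
      else 0)"

definition in_l2 :: "(nat \<Rightarrow> complex) \<Rightarrow> bool" where
  "in_l2 c \<longleftrightarrow> summable (\<lambda>n. (cmod (c n))\<^sup>2)"

definition l2_norm :: "(nat \<Rightarrow> complex) \<Rightarrow> real" where
  "l2_norm c = sqrt (\<Sum>n. (cmod (c n))\<^sup>2)"

definition bessel_sequence :: "real \<Rightarrow> (nat \<Rightarrow> complex \<Rightarrow> complex) \<Rightarrow> bool" where
  "bessel_sequence \<eta> u \<longleftrightarrow>
     (\<forall>n. u n \<in> bergman_space \<eta>) \<and>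
     (\<exists>B>0. \<forall>f\<in>bergman_space \<eta>.
        summable (\<lambda>n. (cmod (bergman_inner \<eta> f (u n)))\<^sup>2) \<and>
        (\<Sum>n. (cmod (bergman_inner \<eta> f (u n)))\<^sup>2) \<le> B * (bergman_norm \<eta> f)\<^sup>2)"

definition atomic_system ::
    "real \<Rightarrow> ((complex \<Rightarrow> complex) \<Rightarrow> (complex \<Rightarrow> complex)) \<Rightarrow> (nat \<Rightarrow> complex \<Rightarrow> complex) \<Rightarrow> bool"
  where
  "atomic_system \<eta> L u \<longleftrightarrow>
     (\<forall>c. in_l2 c \<longrightarrow> (\<exists>h. bergman_sums \<eta> (\<lambda>n z. c n * u n z) h)) \<and>
     (\<exists>C>0. \<forall>f\<in>bergman_space \<eta>. \<exists>a. in_l2 a \<and> l2_norm a \<le> C * bergman_norm \<eta> f \<and>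
        bergman_sums \<eta> (\<lambda>n z. a n * u n z) (L f))"

definition sampling_sequence ::
    "real \<Rightarrow> ((complex \<Rightarrow> complex) \<Rightarrow> (complex \<Rightarrow> complex)) \<Rightarrow> (nat \<Rightarrow> complex) \<Rightarrow> bool"
  where
  "sampling_sequence \<eta> L w \<longleftrightarrow>
     (\<exists>A>0. \<exists>B>0. \<forall>f\<in>bergman_space \<eta>.
        summable (\<lambda>n. (cmod (f (w n)))\<^sup>2 * (1 - (cmod (w n))\<^sup>2) powr (2 + \<eta>)) \<and>
        A * (bergman_norm \<eta> (bergman_adjoint \<eta> L f))\<^sup>2
          \<le> (\<Sum>n. (cmod (f (w n)))\<^sup>2 * (1 - (cmod (w n))\<^sup>2) powr (2 + \<eta>)) \<and>
        (\<Sum>n. (cmod (f (w n)))\<^sup>2 * (1 - (cmod (w n))\<^sup>2) powr (2 + \<eta>))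
          \<le> B * (bergman_norm \<eta> f)\<^sup>2)"

end

theory Submission
  imports Defs "HOL-Library.Function_Algebras"
begin

text \<open>
  The normalized kernels \<open>k n = normalized_kernel \<eta> (w n)\<close> enter only through the reproducing
  property: \<open>\<langle>f, k n\<rangle>\<close> is \<open>f (w n)\<close> times \<open>(1 - (cmod (w n))\<^sup>2) powr (1 + \<eta> / 2)\<close>, so the sums in
  (ii) and (iv) are formed from the coefficient sequence \<open>T f = (\<langle>f, k n\<rangle>)\<close>.  After this
  translation the four conditions make sense, and are equivalent, for every sequence \<open>u\<close> in every
  complex Hilbert space; this is \<open>atomic_system_characterizations\<close>.

  For the abstract equivalence, a Bessel sequence is one whose coefficient map \<open>T\<close> is bounded into
  \<open>l\<^sup>2\<close>.  Its adjoint is the synthesis map \<open>c \<mapsto> \<Sum> c n * u n\<close>, so the Bessel property gives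
  convergence of all these series, and uniform boundedness gives the converse.  If moreover every
  \<open>L f\<close> is synthesized from coefficients of norm at most \<open>C * \<parallel>f\<parallel>\<close>, then pairing with
  \<open>h = adj L f\<close> gives \<open>\<parallel>h\<parallel>\<^sup>2 = \<langle>L h, f\<rangle> \<le> C * \<parallel>h\<parallel> * \<parallel>T f\<parallel>\<close>, the lower sampling inequality.
  From that inequality one returns as in Douglas' factorization lemma: the functional
  \<open>T h \<mapsto> \<langle>h, L f\<rangle>\<close> on the range of \<open>T\<close> is well defined and bounded, so it is represented by a
  unique \<open>b f\<close> in the closure of the range, \<open>b f\<close> synthesizes \<open>L f\<close>, and the coordinates of \<open>b f\<close>
  are bounded functionals of \<open>f\<close>, that is, inner products with vectors \<open>g n\<close>
  (\<open>factorization_if_lower_bound\<close>).  This is (iii), from which (i) follows by taking \<open>\<langle>f, g n\<rangle>\<close> as coefficients.  Finally (iii) and (iv)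
  are exchanged by taking adjoints (\<open>series_adjoint\<close>); in (iv) the Bessel bound is recovered from
  pointwise square-summability by uniform boundedness.

  It remains to see that the Bergman space is a Hilbert space with this reproducing kernel.
  Rotation invariance of area makes the monomials orthogonal, and the substitution
  \<open>t = (cmod z)\<^sup>2\<close> turns their squared norms into Beta integrals; their reciprocals are
  the Taylor coefficients of \<open>(1 - x) powr - (2 + \<eta>)\<close>, and integrating \<open>f\<close> against the resulting power
  series returns the Taylor series of \<open>f\<close> (\<open>bergman_inner_normalized_kernel\<close>).  The kernel bounds
  point evaluations locally uniformly, so Cauchy sequences converge locally uniformly to a
  holomorphic function, and Fatou's lemma upgrades this to convergence in norm.
\<close>

section \<open>Hilbert spaces carried by a set of vectors\<close>

text \<open>
  A fixed space is carried by a subset \<open>H\<close> of an ambient type, because the Bergman space depends on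
  the parameter \<open>\<eta>\<close> and so is not a type.  The form is only assumed semidefinite: the Cauchy-Schwarz
  inequality in this generality is what proves that the Bergman form is definite.
\<close>

locale semi_inner_space = vector_space scale
  for scale :: "complex \<Rightarrow> 'v::ab_group_add \<Rightarrow> 'v" (infixr "\<odot>" 75) +
  fixes H :: "'v set" and ip :: "'v \<Rightarrow> 'v \<Rightarrow> complex"
  assumes subspace_H: "subspace H"
    and ip_add: "\<lbrakk>x \<in> H; y \<in> H; z \<in> H\<rbrakk> \<Longrightarrow> ip (x + y) z = ip x z + ip y z"
    and ip_scale: "\<lbrakk>x \<in> H; y \<in> H\<rbrakk> \<Longrightarrow> ip (c \<odot> x) y = c * ip x y"
    and ip_cnj: "\<lbrakk>x \<in> H; y \<in> H\<rbrakk> \<Longrightarrow> ip y x = cnj (ip x y)"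
    and ip_nonneg: "x \<in> H \<Longrightarrow> 0 \<le> Re (ip x x)"
begin

definition nrm :: "'v \<Rightarrow> real" where
  "nrm x = sqrt (Re (ip x x))"

definition converges_to :: "(nat \<Rightarrow> 'v) \<Rightarrow> 'v \<Rightarrow> bool" where
  "converges_to X x \<longleftrightarrow> (\<lambda>n. nrm (X n - x)) \<longlonglongrightarrow> 0"

lemma zero_H [simp]: "0 \<in> H"
  using subspace_H by (rule subspace_0)

lemma add_H [simp, intro]: "x \<in> H \<Longrightarrow> y \<in> H \<Longrightarrow> x + y \<in> H"
  using subspace_H by (rule subspace_add)

lemma scale_H [simp, intro]: "x \<in> H \<Longrightarrow> c \<odot> x \<in> H"
  using subspace_H by (rule subspace_scale)

lemma diff_H [simp, intro]: "x \<in> H \<Longrightarrow> y \<in> H \<Longrightarrow> x - y \<in> H"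
  using subspace_H by (rule subspace_diff)

lemma sum_H [intro]: "(\<And>i. i \<in> I \<Longrightarrow> u i \<in> H) \<Longrightarrow> sum u I \<in> H"
  using subspace_H by (rule subspace_sum)

lemma ip_add_right:
  assumes "x \<in> H" "y \<in> H" "z \<in> H"
  shows "ip x (y + z) = ip x y + ip x z"
  using assms ip_add[of y z x] by (metis add_H complex_cnj_add ip_cnj)

lemma ip_scale_right:
  assumes "x \<in> H" "y \<in> H"
  shows "ip x (c \<odot> y) = cnj c * ip x y"
  using assms ip_scale[of y x c] by (metis complex_cnj_mult ip_cnj scale_H)

lemma ip_diff:
  assumes "x \<in> H" "y \<in> H" "z \<in> H"
  shows "ip (x - y) z = ip x z - ip y z"
  using ip_add[of "x - y" y z] assms by simp

lemma ip_diff_right: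
  assumes "x \<in> H" "y \<in> H" "z \<in> H"
  shows "ip x (y - z) = ip x y - ip x z"
  using ip_add_right[of x "y - z" z] assms by simp

lemma ip_zero [simp]: "x \<in> H \<Longrightarrow> ip 0 x = 0" "x \<in> H \<Longrightarrow> ip x 0 = 0"
  using ip_diff[of x x x] ip_diff_right[of x x x] by simp_all

lemma ip_sum:
  assumes "\<And>i. i \<in> I \<Longrightarrow> u i \<in> H" "x \<in> H"
  shows "ip (sum u I) x = (\<Sum>i\<in>I. ip (u i) x)"
  using assms(1)
proof (induction I rule: infinite_finite_induct)
  case (insert i I)
  then have "sum u I \<in> H" by blast
  with insert show ?case by (simp add: ip_add assms(2))
qed (use assms(2) in auto)

lemma nrm_nonneg [simp]: "x \<in> H \<Longrightarrow> 0 \<le> nrm x"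
  by (simp add: nrm_def ip_nonneg)

lemma nrm_zero [simp]: "nrm 0 = 0"
  by (simp add: nrm_def)

lemma nrm_sq: "x \<in> H \<Longrightarrow> (nrm x)\<^sup>2 = Re (ip x x)"
  by (simp add: nrm_def ip_nonneg)

lemma ip_self: "x \<in> H \<Longrightarrow> ip x x = of_real ((nrm x)\<^sup>2)"
  using ip_cnj[of x x] by (simp add: nrm_sq complex_eq_iff)

lemma nrm_sq_add:
  assumes "x \<in> H" "y \<in> H"
  shows "(nrm (x + y))\<^sup>2 = (nrm x)\<^sup>2 + 2 * Re (ip x y) + (nrm y)\<^sup>2"
  using assms ip_cnj[OF assms] by (simp add: nrm_sq ip_add ip_add_right)

lemma nrm_sq_diff:
  assumes "x \<in> H" "y \<in> H"
  shows "(nrm (x - y))\<^sup>2 = (nrm x)\<^sup>2 - 2 * Re (ip x y) + (nrm y)\<^sup>2"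
  using assms ip_cnj[OF assms] by (simp add: nrm_sq ip_diff ip_diff_right)

lemma nrm_scale:
  assumes "x \<in> H"
  shows "nrm (c \<odot> x) = cmod c * nrm x"
proof -
  have "ip (c \<odot> x) (c \<odot> x) = of_real ((cmod c)\<^sup>2 * (nrm x)\<^sup>2)"
    using assms unfolding of_real_mult complex_norm_square
    by (simp only: ip_scale ip_scale_right ip_self[OF assms, symmetric] mult_ac scale_H)
  then have "(nrm (c \<odot> x))\<^sup>2 = (cmod c * nrm x)\<^sup>2"
    using assms by (simp add: nrm_sq power_mult_distrib)
  then show ?thesis
    using assms by (simp add: power2_eq_iff_nonneg)
qed

lemma nrm_minus: "x \<in> H \<Longrightarrow> nrm (- x) = nrm x"
  using nrm_scale[of x "-1"] by simp

lemma nrm_minus_commute: "x \<in> H \<Longrightarrow> y \<in> H \<Longrightarrow> nrm (x - y) = nrm (y - x)"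
  using nrm_minus[of "x - y"] by simp

lemma parallelogram:
  assumes "x \<in> H" "y \<in> H"
  shows "(nrm (x - y))\<^sup>2 + (nrm (x + y))\<^sup>2 = 2 * (nrm x)\<^sup>2 + 2 * (nrm y)\<^sup>2"
  using assms by (simp add: nrm_sq ip_add ip_add_right ip_diff ip_diff_right)

text \<open>
  The square of the norm of \<open>x - t * ip x y * y\<close> is a quadratic polynomial in the real number \<open>t\<close>
  that is never negative.  If \<open>nrm y = 0\<close> it is affine, which forces its slope to vanish;
  otherwise its value at \<open>t = 1 / (nrm y)\<^sup>2\<close> is the claim.
\<close>

lemma cauchy_schwarz:
  assumes x: "x \<in> H" and y: "y \<in> H"
  shows "cmod (ip x y) \<le> nrm x * nrm y"
proof -
  define a where "a = ip x y"
  have quad: "0 \<le> (nrm x)\<^sup>2 - 2 * t * (cmod a)\<^sup>2 + t\<^sup>2 * (cmod a)\<^sup>2 * (nrm y)\<^sup>2" for t :: real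
  proof -
    let ?c = "of_real t * a"
    have "Re (ip x (?c \<odot> y)) = t * (cmod a)\<^sup>2"
      using x y by (simp add: ip_scale_right a_def[symmetric] cmod_power2)
        (simp add: power2_eq_square algebra_simps)
    moreover have "(nrm (?c \<odot> y))\<^sup>2 = t\<^sup>2 * (cmod a)\<^sup>2 * (nrm y)\<^sup>2"
      using y by (simp add: nrm_scale norm_mult power_mult_distrib)
    moreover have "0 \<le> (nrm (x - ?c \<odot> y))\<^sup>2" by simp
    ultimately show ?thesis
      using nrm_sq_diff[of x "?c \<odot> y"] x y by simp
  qed
  show ?thesis
  proof (cases "nrm y = 0")
    case True
    have "cmod a = 0"
    proof (rule ccontr)
      assume "cmod a \<noteq> 0"
      then show False
        \<comment> \<open>at this \<open>t\<close> the affine function takes the value \<open>- 1\<close>\<close>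
        using quad[of "((nrm x)\<^sup>2 + 1) / (2 * (cmod a)\<^sup>2)"] True by simp
    qed
    then show ?thesis by (simp add: a_def True)
  next
    case False
    have "0 \<le> (nrm x)\<^sup>2 - (cmod a)\<^sup>2 / (nrm y)\<^sup>2"
      using quad[of "1 / (nrm y)\<^sup>2"] False by (simp add: power2_eq_square field_simps)
    then have "(cmod a)\<^sup>2 \<le> (nrm x * nrm y)\<^sup>2"
      using False by (simp add: field_simps power_mult_distrib)
    then show ?thesis
      using x y by (simp add: a_def power2_le_iff_abs_le)
  qed
qed

lemma nrm_triangle:
  assumes "x \<in> H" "y \<in> H"
  shows "nrm (x + y) \<le> nrm x + nrm y"
proof -
  have "Re (ip x y) \<le> nrm x * nrm y"
    using cauchy_schwarz[OF assms] complex_Re_le_cmod order_trans by blast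
  then have "(nrm (x + y))\<^sup>2 \<le> (nrm x + nrm y)\<^sup>2"
    using nrm_sq_add[OF assms] by (simp add: power2_sum)
  then show ?thesis
    using assms by (simp add: power2_le_iff_abs_le)
qed

lemma nrm_triangle_diff:
  assumes "x \<in> H" "y \<in> H" "z \<in> H"
  shows "nrm (x - z) \<le> nrm (x - y) + nrm (y - z)"
  using nrm_triangle[of "x - y" "y - z"] assms by simp

lemma nrm_le_add_diff:
  assumes "x \<in> H" "y \<in> H"
  shows "nrm x \<le> nrm y + nrm (x - y)"
  using nrm_triangle[of y "x - y"] assms by simp

lemma tendsto_ip:
  assumes "converges_to X x" "\<And>n. X n \<in> H" "x \<in> H" "y \<in> H"
  shows "(\<lambda>n. ip (X n) y) \<longlonglongrightarrow> ip x y"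
proof -
  have "(\<lambda>n. ip (X n) y - ip x y) \<longlonglongrightarrow> 0"
  proof (rule Lim_null_comparison)
    show "\<forall>\<^sub>F n in sequentially. norm (ip (X n) y - ip x y) \<le> nrm (X n - x) * nrm y"
      using assms cauchy_schwarz by (simp flip: ip_diff)
    show "(\<lambda>n. nrm (X n - x) * nrm y) \<longlonglongrightarrow> 0"
      using assms(1) tendsto_mult_left_zero unfolding converges_to_def by blast
  qed
  then show ?thesis by (simp add: LIM_zero_iff)
qed

lemma tendsto_ip_right:
  assumes "converges_to X x" "\<And>n. X n \<in> H" "x \<in> H" "y \<in> H"
  shows "(\<lambda>n. ip y (X n)) \<longlonglongrightarrow> ip y x"
  using tendsto_cnj[OF tendsto_ip[OF assms]] assms(2-4) by (simp only: ip_cnj[symmetric])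

lemma tendsto_nrm:
  assumes "converges_to X x" "\<And>n. X n \<in> H" "x \<in> H"
  shows "(\<lambda>n. nrm (X n)) \<longlonglongrightarrow> nrm x"
proof -
  have "(\<lambda>n. nrm (X n) - nrm x) \<longlonglongrightarrow> 0"
  proof (rule Lim_null_comparison)
    have "\<bar>nrm (X n) - nrm x\<bar> \<le> nrm (X n - x)" for n
      using nrm_le_add_diff[of "X n" x] nrm_le_add_diff[of x "X n"] assms
        nrm_minus_commute[of x "X n"] by (simp add: abs_le_iff)
    then show "\<forall>\<^sub>F n in sequentially. norm (nrm (X n) - nrm x) \<le> nrm (X n - x)"
      by simp
  qed (use assms in \<open>simp add: converges_to_def\<close>)
  then show ?thesis by (simp add: LIM_zero_iff)
qed

end

locale hilbert_space = semi_inner_space scale H ip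
  for scale :: "complex \<Rightarrow> 'v::ab_group_add \<Rightarrow> 'v" (infixr "\<odot>" 75) and H ip +
  assumes definite: "\<lbrakk>x \<in> H; nrm x = 0\<rbrakk> \<Longrightarrow> x = 0"
    and complete: "\<lbrakk>\<And>n. X n \<in> H;
        \<And>e. 0 < e \<Longrightarrow> \<exists>M. \<forall>m\<ge>M. \<forall>n\<ge>M. nrm (X m - X n) < e\<rbrakk> \<Longrightarrow>
        \<exists>x\<in>H. converges_to X x"
begin

lemma eq_if_ip_eq:
  assumes "x \<in> H" "y \<in> H" "\<And>z. z \<in> H \<Longrightarrow> ip z x = ip z y"
  shows "x = y"
proof -
  have "(nrm (x - y))\<^sup>2 = 0"
    using assms by (simp add: nrm_sq ip_diff_right)
  then show ?thesis using definite[of "x - y"] assms by simp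
qed

definition lim_set :: "'v set \<Rightarrow> 'v set" where
  "lim_set S = {b \<in> H. \<exists>s. range s \<subseteq> S \<and> converges_to s b}"

text \<open>
  Riesz representation on a subspace that need not be closed: \<^term>\<open>(nrm x)\<^sup>2 - 2 * Re (\<phi> x)\<close>
  is bounded below on \<^term>\<open>S\<close>, the parallelogram law makes every minimising sequence Cauchy,
  and the limit represents \<^term>\<open>\<phi>\<close>.  The representing vector is a limit of elements of
  \<^term>\<open>S\<close>, which makes it unique.
\<close>
lemma riesz_subspace:
  assumes S: "subspace S" "S \<subseteq> H"
    and add: "\<And>x y. \<lbrakk>x \<in> S; y \<in> S\<rbrakk> \<Longrightarrow> \<phi> (x + y) = \<phi> x + \<phi> y"
    and scale: "\<And>c x. x \<in> S \<Longrightarrow> \<phi> (c \<odot> x) = c * \<phi> x"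
    and bound: "\<And>x. x \<in> S \<Longrightarrow> cmod (\<phi> x) \<le> M * nrm x" and M: "0 \<le> M"
  shows "\<exists>b\<in>lim_set S. (\<forall>x\<in>S. \<phi> x = ip x b) \<and> nrm b \<le> M"
proof -
  define J where "J x = (nrm x)\<^sup>2 - 2 * Re (\<phi> x)" for x
  define d where "d = Inf (J ` S)"
  have S_H [simp]: "x \<in> S \<Longrightarrow> x \<in> H" for x using S by blast
  have J_lower: "- M\<^sup>2 \<le> J x" if "x \<in> S" for x
  proof -
    have "Re (\<phi> x) \<le> M * nrm x"
      using bound[OF that] complex_Re_le_cmod order_trans by blast
    moreover have "0 \<le> (nrm x - M)\<^sup>2" by simp
    ultimately show ?thesis
      by (simp add: J_def power2_diff algebra_simps)
  qed
  then have bdd: "bdd_below (J ` S)" by (auto intro!: bdd_belowI)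
  have d_le: "d \<le> J x" if "x \<in> S" for x
    unfolding d_def using bdd that by (rule cINF_lower)
  have "S \<noteq> {}" using subspace_0[OF S(1)] by auto
  have "\<exists>x\<in>S. J x < d + 1 / (real n + 1)" for n
  proof -
    have "Inf (J ` S) < d + 1 / (real n + 1)" by (simp add: d_def)
    then show ?thesis
      using cInf_lessD[of "J ` S"] \<open>S \<noteq> {}\<close> by fastforce
  qed
  then obtain s where s: "\<And>n. s n \<in> S" "\<And>n. J (s n) < d + 1 / (real n + 1)"
    by metis
  have s_H [simp]: "s n \<in> H" for n using s(1) by simp
  have gap: "(nrm (s m - s n))\<^sup>2 \<le> 2 / (real m + 1) + 2 / (real n + 1)" for m n
  proof -
    let ?z = "(1/2) \<odot> (s m + s n)"
    have z: "?z \<in> S" using s(1) S(1) by (simp add: subspace_add subspace_scale)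
    have "J ?z = (nrm (s m + s n))\<^sup>2 / 4 - Re (\<phi> (s m)) - Re (\<phi> (s n))"
    proof -
      have "s m + s n \<in> S" using s(1) S(1) by (simp add: subspace_add)
      then have "nrm ?z = nrm (s m + s n) / 2" "\<phi> ?z = (\<phi> (s m) + \<phi> (s n)) / 2"
        using s(1) by (simp_all add: nrm_scale scale add del: scale_right_distrib)
      then show ?thesis unfolding J_def by (simp only: power_divide) (simp add: add_divide_distrib)
    qed
    then have "(nrm (s m - s n))\<^sup>2 = 2 * J (s m) + 2 * J (s n) - 4 * J ?z"
      using parallelogram[of "s m" "s n"] by (simp add: J_def)
    then show ?thesis
      using d_le[OF z] s(2)[of m] s(2)[of n] by simp
  qed
  have "\<exists>M. \<forall>m\<ge>M. \<forall>n\<ge>M. nrm (s m - s n) < e" if "0 < e" for e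
  proof -
    obtain K where K: "4 / e\<^sup>2 < real K" using reals_Archimedean2 by blast
    have "nrm (s m - s n) < e" if "m \<ge> K" "n \<ge> K" for m n
    proof -
      have "1 / (real k + 1) < e\<^sup>2 / 4" if "k \<ge> K" for k
      proof -
        have "4 / e\<^sup>2 < real k + 1" using K that by linarith
        then show ?thesis using \<open>0 < e\<close> by (simp add: field_simps)
      qed
      from this[OF that(1)] this[OF that(2)] have "(nrm (s m - s n))\<^sup>2 < e\<^sup>2"
        using gap[of m n] by linarith
      then show ?thesis using \<open>0 < e\<close> by (simp add: power2_less_imp_less)
    qed
    then show ?thesis by blast
  qed
  then obtain b where b: "b \<in> H" "converges_to s b"
    using complete[of s] by auto
  have rep: "\<phi> x = ip x b" if x: "x \<in> S" for x
  proof -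
    define D where "D = ip x b - \<phi> x"
    \<comment> \<open>first variation of \<open>J\<close> at the limit of the minimising sequence, in the direction \<open>c \<odot> x\<close>\<close>
    have var: "0 \<le> 2 * Re (c * D) + (cmod c)\<^sup>2 * (nrm x)\<^sup>2" for c
    proof (rule LIMSEQ_le)
      show "(\<lambda>n. - (1 / (real n + 1))) \<longlonglongrightarrow> 0"
        using tendsto_minus[OF LIMSEQ_inverse_real_of_nat]
        by (simp add: inverse_eq_divide add.commute)
      show "(\<lambda>n. 2 * Re (c * (ip x (s n) - \<phi> x)) + (cmod c)\<^sup>2 * (nrm x)\<^sup>2)
          \<longlonglongrightarrow> 2 * Re (c * D) + (cmod c)\<^sup>2 * (nrm x)\<^sup>2"
        unfolding D_def using x b by (intro tendsto_intros tendsto_ip_right) auto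
      have "- (1 / (real n + 1)) \<le> 2 * Re (c * (ip x (s n) - \<phi> x)) + (cmod c)\<^sup>2 * (nrm x)\<^sup>2" for n
      proof -
        have cx: "c \<odot> x \<in> S" using S(1) x by (rule subspace_scale)
        have "J (s n + c \<odot> x) = J (s n) + 2 * Re (c * (ip x (s n) - \<phi> x))
            + (cmod c)\<^sup>2 * (nrm x)\<^sup>2"
          using x cx s(1) ip_cnj[of "c \<odot> x" "s n"]
          by (simp add: J_def nrm_sq_add nrm_scale add scale ip_scale power_mult_distrib
              right_diff_distrib)
        then show ?thesis
          using d_le[of "s n + c \<odot> x"] s(2)[of n] subspace_add[OF S(1) s(1) cx] by simp
      qed
      then show "\<exists>N. \<forall>n\<ge>N. - (1 / (real n + 1))
          \<le> 2 * Re (c * (ip x (s n) - \<phi> x)) + (cmod c)\<^sup>2 * (nrm x)\<^sup>2" by auto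
    qed
    have "cmod D = 0"
    proof (rule ccontr)
      assume D: "cmod D \<noteq> 0"
      \<comment> \<open>a step against \<open>D\<close>, short enough that the linear term beats the quadratic one\<close>
      define t where "t = 1 / ((nrm x)\<^sup>2 + 1)"
      have t: "0 < t" "t * (nrm x)\<^sup>2 < 1"
        using zero_le_power2[of "nrm x"] by (simp_all add: t_def add_nonneg_pos)
      define c where "c = - (of_real t * cnj D)"
      have c: "Re (c * D) = - (t * (cmod D)\<^sup>2)" "(cmod c)\<^sup>2 = t\<^sup>2 * (cmod D)\<^sup>2"
        by (simp_all add: c_def cmod_power2 norm_mult power_mult_distrib)
          (simp_all add: power2_eq_square algebra_simps)
      have "0 \<le> - (2 * t * (cmod D)\<^sup>2) + t\<^sup>2 * (cmod D)\<^sup>2 * (nrm x)\<^sup>2"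
        using var[of c] unfolding c by linarith
      also have "\<dots> = t * (cmod D)\<^sup>2 * (t * (nrm x)\<^sup>2 - 2)"
        by (simp add: power2_eq_square algebra_simps)
      also have "\<dots> < 0"
        using t D by (intro mult_pos_neg) auto
      finally show False by simp
    qed
    then show ?thesis by (simp add: D_def)
  qed
  have "(nrm b)\<^sup>2 \<le> M * nrm b"
  proof (rule LIMSEQ_le)
    show "(\<lambda>n. cmod (ip (s n) b)) \<longlonglongrightarrow> (nrm b)\<^sup>2"
      using tendsto_norm[OF tendsto_ip[OF b(2) s_H b(1) b(1)]] b(1)
      by (simp add: ip_self norm_power)
    show "(\<lambda>n. M * nrm (s n)) \<longlonglongrightarrow> M * nrm b"
      by (intro tendsto_intros tendsto_nrm b s_H)
    show "\<exists>N. \<forall>n\<ge>N. cmod (ip (s n) b) \<le> M * nrm (s n)"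
      using bound rep s(1) by auto
  qed
  then have "nrm b \<le> M"
    using b(1) M nrm_nonneg[OF b(1)]
    by (cases "nrm b = 0") (simp_all add: power2_eq_square)
  moreover have "b \<in> lim_set S" using s(1) b by (auto simp: lim_set_def)
  ultimately show ?thesis using rep by blast
qed

lemma riesz:
  assumes "\<And>x y. \<lbrakk>x \<in> H; y \<in> H\<rbrakk> \<Longrightarrow> \<phi> (x + y) = \<phi> x + \<phi> y"
    and "\<And>c x. x \<in> H \<Longrightarrow> \<phi> (c \<odot> x) = c * \<phi> x"
    and "\<And>x. x \<in> H \<Longrightarrow> cmod (\<phi> x) \<le> M * nrm x"
  shows "\<exists>b\<in>H. \<forall>x\<in>H. \<phi> x = ip x b"
proof -
  have "cmod (\<phi> x) \<le> max M 0 * nrm x" if "x \<in> H" for x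
    using assms(3)[OF that] mult_right_mono[OF max.cobounded1 nrm_nonneg[OF that], of M 0]
    by linarith
  from riesz_subspace[OF subspace_H order_refl assms(1,2) this max.cobounded2]
  show ?thesis by (auto simp: lim_set_def)
qed


section \<open>Uniform boundedness and Bessel sequences\<close>

lemma convergent_if_cauchy_bound:
  assumes X: "\<And>n. X n \<in> H"
    and bound: "\<And>m n. n \<le> m \<Longrightarrow> nrm (X m - X n) \<le> a n" and a: "a \<longlonglongrightarrow> 0"
  shows "\<exists>x\<in>H. converges_to X x"
proof (rule complete[OF X])
  fix e :: real assume "0 < e"
  then have "\<forall>\<^sub>F n in sequentially. a n < e" using order_tendstoD(2)[OF a] by blast
  then obtain M where M: "\<And>n. n \<ge> M \<Longrightarrow> a n < e" by (auto simp: eventually_sequentially)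
  have "nrm (X m - X n) < e" if "m \<ge> M" "n \<ge> M" for m n
  proof (cases "n \<le> m")
    case True
    then show ?thesis using bound[of n m] M[OF that(2)] by linarith
  next
    case False
    then show ?thesis
      using bound[of m n] M[OF that(1)] nrm_minus_commute[OF X X, of m n] by simp
  qed
  then show "\<exists>M. \<forall>m\<ge>M. \<forall>n\<ge>M. nrm (X m - X n) < e" by blast
qed

text \<open>
  Sokal's proof of the Banach-Steinhaus theorem, stated for seminorms so that it applies both to
  the \<open>l\<^sup>2\<close> norms of finitely many coefficients and to the norms of partial sums.  If the operator norms
  \<open>q N\<close> were unbounded, choose \<open>N n\<close> with \<open>q (N n) > 4 ^ n\<close> and an almost extremal vector \<open>v n\<close> of
  norm at most \<open>1 / 3 ^ n\<close>.  Since \<open>2 * p v \<le> p (x + v) + p (x - v)\<close>, adding or subtracting \<open>v n\<close>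
  makes the \<open>n\<close>-th seminorm of the running sum at least \<open>p (v n)\<close>, and all later
  steps together have norm at most \<open>1 / 2 * (1 / 3) ^ n\<close>, too little to undo this.  At the limit
  the seminorms then grow at least like \<open>(4 / 3) ^ n / 6\<close>.
\<close>

lemma uniform_boundedness:
  fixes p :: "nat \<Rightarrow> 'v \<Rightarrow> real"
  assumes add: "\<And>N x y. \<lbrakk>x \<in> H; y \<in> H\<rbrakk> \<Longrightarrow> p N (x + y) \<le> p N x + p N y"
    and scale: "\<And>N c x. x \<in> H \<Longrightarrow> p N (c \<odot> x) = cmod c * p N x"
    and bound: "\<And>N x. x \<in> H \<Longrightarrow> p N x \<le> K N * nrm x"
    and pointwise: "\<And>x. x \<in> H \<Longrightarrow> \<exists>C. \<forall>N. p N x \<le> C"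
  shows "\<exists>M>0. \<forall>x\<in>H. \<forall>N. p N x \<le> M * nrm x"
proof (rule ccontr)
  assume contr: "\<not> ?thesis"
  have p_minus: "p N (- x) = p N x" if "x \<in> H" for N x
    using scale[OF that, of N "-1"] by simp
  have p_diff: "p N (x - y) \<le> p N x + p N y" if "x \<in> H" "y \<in> H" for N x y
    using add[of x "- y" N] scale_H[of y "-1"] p_minus that by simp
  define q where "q N = Sup (p N ` {x \<in> H. nrm x \<le> 1})" for N
  have bdd: "bdd_above (p N ` {x \<in> H. nrm x \<le> 1})" for N
  proof (rule bdd_aboveI2)
    fix x assume x: "x \<in> {x \<in> H. nrm x \<le> 1}"
    then have "K N * nrm x \<le> \<bar>K N\<bar> * 1" by (intro mult_mono) auto
    then show "p N x \<le> \<bar>K N\<bar>" using bound[of x N] x by simp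
  qed
  have q_upper: "p N x \<le> q N" if "x \<in> H" "nrm x \<le> 1" for N x
    unfolding q_def using bdd that by (intro cSUP_upper) auto
  have q_nonneg: "0 \<le> q N" for N
    using q_upper[of 0 N] scale[of 0 N 0] by simp
  have p_le: "p N x \<le> q N * nrm x" if x: "x \<in> H" for N x
  proof (cases "nrm x = 0")
    case True
    then show ?thesis using bound[OF x, of N] by simp
  next
    case False
    then have pos: "0 < nrm x" using nrm_nonneg[OF x] by simp
    have "p N (of_real (1 / nrm x) \<odot> x) \<le> q N"
      using pos x by (intro q_upper) (auto simp: nrm_scale norm_divide)
    then show ?thesis using pos x by (simp add: scale norm_divide field_simps)
  qed
  have "\<exists>N. 4 ^ n < q N" for n :: nat
  proof (rule ccontr)
    assume "\<not> ?thesis"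
    then have "q N \<le> 4 ^ n" for N by (simp add: not_less)
    then have "q N * nrm x \<le> 4 ^ n * nrm x" if "x \<in> H" for N x
      using that by (intro mult_right_mono) auto
    then have "\<forall>x\<in>H. \<forall>N. p N x \<le> 4 ^ n * nrm x"
      using p_le order_trans by blast
    moreover have "(0::real) < 4 ^ n" by simp
    ultimately show False using contr by blast
  qed
  then obtain N where N: "\<And>n :: nat. 4 ^ n < q (N n)" by metis
  have "\<exists>y\<in>H. nrm y \<le> 1 \<and> 2 / 3 * q (N n) < p (N n) y" for n
  proof -
    have "0 < q (N n)" using less_trans[OF _ N[of n], of 0] by simp
    then have "2 / 3 * q (N n) < Sup (p (N n) ` {x \<in> H. nrm x \<le> 1})"
      by (simp add: q_def[symmetric])
    moreover have "0 \<in> {x \<in> H. nrm x \<le> 1}" by simp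
    ultimately show ?thesis
      using less_cSupD[of "p (N n) ` {x \<in> H. nrm x \<le> 1}"] by blast
  qed
  then obtain y where y: "\<And>n. y n \<in> H" "\<And>n. nrm (y n) \<le> 1"
      "\<And>n. 2 / 3 * q (N n) < p (N n) (y n)"
    by metis
  define v where "v n = of_real (1 / 3 ^ n) \<odot> y n" for n
  have v: "v n \<in> H" "nrm (v n) \<le> 1 / 3 ^ n" "2 / 3 * q (N n) / 3 ^ n \<le> p (N n) (v n)" for n
    using y(1,2)[of n] y(3)[of n]
    by (simp_all add: v_def nrm_scale scale norm_divide norm_power divide_right_mono less_imp_le)
      (simp add: field_simps)
  define X where "X = rec_nat 0 (\<lambda>n x. if p (N n) (v n) \<le> p (N n) (x + v n) then x + v n else x - v n)"
  have X_Suc: "X (Suc n) = (if p (N n) (v n) \<le> p (N n) (X n + v n) then X n + v n else X n - v n)" for n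
    by (simp add: X_def)
  have X_H: "X n \<in> H" for n
    by (induction n) (auto simp: X_Suc v, simp add: X_def)
  have X_large: "p (N n) (v n) \<le> p (N n) (X (Suc n))" for n
  proof (cases "p (N n) (v n) \<le> p (N n) (X n + v n)")
    case False
    have "2 \<odot> v n = (X n + v n) - (X n - v n)"
      using scale_left_distrib[of 1 1 "v n"] by simp
    then have "2 * p (N n) (v n) \<le> p (N n) (X n + v n) + p (N n) (X n - v n)"
      using scale[OF v(1), of "N n" 2 n] p_diff[of "X n + v n" "X n - v n" "N n"] X_H v(1) by simp
    with False show ?thesis by (simp add: X_Suc)
  qed (simp add: X_Suc)
  have X_step: "nrm (X (Suc n) - X n) \<le> 1 / 3 ^ n" for n
    using v(1,2)[of n] by (simp add: X_Suc nrm_minus)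
  define e where "e n = (1 / 3 :: real) ^ n" for n
  have e: "e (Suc n) = e n / 3" "0 < e n" for n
    by (simp_all add: e_def)
  have X_tele: "nrm (X (n + k) - X n) \<le> 3 / 2 * (e n - e (n + k))" for n k
  proof (induction k)
    case (Suc k)
    have "nrm (X (n + Suc k) - X n) \<le> nrm (X (Suc (n + k)) - X (n + k)) + nrm (X (n + k) - X n)"
      using nrm_triangle_diff[of "X (n + Suc k)" "X (n + k)" "X n"] X_H by simp
    moreover have "nrm (X (Suc (n + k)) - X (n + k)) \<le> e (n + k)"
      using X_step[of "n + k"] by (simp add: e_def power_divide)
    ultimately have "nrm (X (n + Suc k) - X n) \<le> e (n + k) + 3 / 2 * (e n - e (n + k))"
      using Suc by linarith
    also have "\<dots> = 3 / 2 * (e n - e (n + Suc k))" by (simp add: e(1) field_simps)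
    finally show ?case .
  qed simp
  have X_bound: "nrm (X m - X n) \<le> 3 / 2 * (1 / 3) ^ n" if nm: "n \<le> m" for m n
  proof -
    obtain k where m: "m = n + k" using le_Suc_ex[OF nm] by auto
    show ?thesis using X_tele[of n k] e(2)[of "n + k"] unfolding m e_def[of n, symmetric] by simp
  qed
  have "(\<lambda>n. 3 / 2 * (1 / 3 :: real) ^ n) \<longlonglongrightarrow> 0"
    by (intro tendsto_mult_right_zero LIMSEQ_power_zero) simp
  then obtain x where x: "x \<in> H" "converges_to X x"
    using convergent_if_cauchy_bound[of X, OF X_H X_bound] by auto
  have x_close: "nrm (x - X (Suc n)) \<le> 1 / 2 * (1 / 3) ^ n" for n
  proof -
    have "nrm (x - X (Suc n)) \<le> nrm (X m - x) + 1 / 2 * (1 / 3) ^ n" if "Suc n \<le> m" for m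
      using nrm_triangle_diff[of x "X m" "X (Suc n)"] X_bound[OF that] x(1) X_H
        nrm_minus_commute[of x "X m"] by simp
    then have ev: "\<exists>M. \<forall>m\<ge>M. nrm (x - X (Suc n)) \<le> nrm (X m - x) + 1 / 2 * (1 / 3) ^ n" by blast
    have "(\<lambda>m. nrm (X m - x) + 1 / 2 * (1 / 3) ^ n) \<longlonglongrightarrow> 0 + 1 / 2 * (1 / 3) ^ n"
      using x(2) unfolding converges_to_def by (intro tendsto_intros)
    from LIMSEQ_le_const[OF this ev] show ?thesis by simp
  qed
  obtain C where C: "\<And>N. p N x \<le> C" using pointwise[OF x(1)] by blast
  have "(4 / 3) ^ n \<le> 6 * C" for n
  proof -
    have "p (N n) (X (Suc n)) \<le> p (N n) x + p (N n) (x - X (Suc n))"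
      using p_diff[of x "x - X (Suc n)" "N n"] x(1) X_H by simp
    moreover have "p (N n) (x - X (Suc n)) \<le> q (N n) * (1 / 2 * (1 / 3) ^ n)"
      by (rule order_trans[OF p_le mult_left_mono[OF x_close q_nonneg]]) (use x(1) X_H in auto)
    ultimately have "2 / 3 * q (N n) / 3 ^ n \<le> C + q (N n) / 2 / 3 ^ n"
      using X_large[of n] v(3)[of n] C[of "N n"] by (simp add: power_divide)
    then have "q (N n) / 3 ^ n \<le> 6 * C" by simp
    moreover have "(4 / 3) ^ n \<le> q (N n) / 3 ^ n"
      using N[of n] by (simp add: power_divide divide_right_mono)
    ultimately show ?thesis by linarith
  qed
  moreover obtain n where "6 * C < (4 / 3 :: real) ^ n"
    using real_arch_pow[of "4 / 3"] by auto
  ultimately show False using leD by blast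
qed

lemma subspace_lim_set:
  assumes S: "subspace S" "S \<subseteq> H"
  shows "subspace (lim_set S)"
proof (rule subspaceI)
  show "0 \<in> lim_set S"
    using subspace_0[OF S(1)] by (auto simp: lim_set_def converges_to_def intro!: exI[of _ "\<lambda>_. 0"])
next
  fix x y assume "x \<in> lim_set S" "y \<in> lim_set S"
  then obtain s t where st: "range s \<subseteq> S" "range t \<subseteq> S" "converges_to s x" "converges_to t y"
      and xy: "x \<in> H" "y \<in> H"
    by (auto simp: lim_set_def)
  have stH: "s n \<in> H" "t n \<in> H" for n using st S by auto
  have "converges_to (\<lambda>n. s n + t n) (x + y)"
    unfolding converges_to_def
  proof (rule Lim_null_comparison)
    have "nrm (s n + t n - (x + y)) \<le> nrm (s n - x) + nrm (t n - y)" for n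
      using nrm_triangle[of "s n - x" "t n - y"] xy stH by (simp add: algebra_simps)
    then show "\<forall>\<^sub>F n in sequentially. norm (nrm (s n + t n - (x + y))) \<le> nrm (s n - x) + nrm (t n - y)"
      using xy stH by simp
    show "(\<lambda>n. nrm (s n - x) + nrm (t n - y)) \<longlonglongrightarrow> 0"
      using st(3,4) unfolding converges_to_def by (rule tendsto_add_zero)
  qed
  moreover have "range (\<lambda>n. s n + t n) \<subseteq> S" using st subspace_add[OF S(1)] by blast
  ultimately show "x + y \<in> lim_set S" using xy by (auto simp: lim_set_def)
next
  fix c x assume "x \<in> lim_set S"
  then obtain s where s: "range s \<subseteq> S" "converges_to s x" and x: "x \<in> H"
    by (auto simp: lim_set_def)
  have sH: "s n \<in> H" for n using s S by auto
  have "nrm (c \<odot> s n - c \<odot> x) = cmod c * nrm (s n - x)" for n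
    using nrm_scale[of "s n - x" c] sH x by (simp add: scale_right_diff_distrib)
  then have "converges_to (\<lambda>n. c \<odot> s n) (c \<odot> x)"
    using s(2) by (simp add: converges_to_def tendsto_mult_right_zero)
  moreover have "range (\<lambda>n. c \<odot> s n) \<subseteq> S" using s subspace_scale[OF S(1)] by blast
  ultimately show "c \<odot> x \<in> lim_set S" using x by (auto simp: lim_set_def)
qed

text \<open>
  Gives uniqueness in \<open>riesz_subspace\<close>: two representing vectors in \<open>lim_set S\<close> have a difference
  that is orthogonal to \<open>S\<close>.
\<close>

lemma lim_set_orthogonal_eq_0:
  assumes "S \<subseteq> H" "x \<in> lim_set S" "\<And>y. y \<in> S \<Longrightarrow> ip y x = 0"
  shows "x = 0"
proof -
  obtain s where s: "range s \<subseteq> S" "converges_to s x" and x: "x \<in> H"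
    using assms(2) by (auto simp: lim_set_def)
  have "(\<lambda>n. ip (s n) x) \<longlonglongrightarrow> ip x x"
    using s x assms(1) by (intro tendsto_ip) auto
  moreover have "ip (s n) x = 0" for n using s(1) assms(3) by blast
  ultimately have "ip x x = 0" by (simp add: LIMSEQ_const_iff)
  then show ?thesis using definite[OF x] by (simp add: nrm_def)
qed

definition bessel :: "(nat \<Rightarrow> 'v) \<Rightarrow> bool" where
  "bessel u \<longleftrightarrow> (\<forall>n. u n \<in> H) \<and>
     (\<exists>B>0. \<forall>f\<in>H. summable (\<lambda>n. (cmod (ip f (u n)))\<^sup>2) \<and>
        (\<Sum>n. (cmod (ip f (u n)))\<^sup>2) \<le> B * (nrm f)\<^sup>2)"

definition series_to :: "(nat \<Rightarrow> complex) \<Rightarrow> (nat \<Rightarrow> 'v) \<Rightarrow> 'v \<Rightarrow> bool" where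
  "series_to c u h \<longleftrightarrow> converges_to (\<lambda>N. \<Sum>n<N. c n \<odot> u n) h"

lemma besselI:
  assumes "\<And>n. u n \<in> H" and B: "0 < B"
    and bound: "\<And>f N. f \<in> H \<Longrightarrow> (\<Sum>n<N. (cmod (ip f (u n)))\<^sup>2) \<le> B * (nrm f)\<^sup>2"
  shows "bessel u"
proof -
  have "summable (\<lambda>n. (cmod (ip f (u n)))\<^sup>2)" if "f \<in> H" for f
    by (rule summableI_nonneg_bounded[OF _ bound[OF that]]) simp
  moreover from this have "(\<Sum>n. (cmod (ip f (u n)))\<^sup>2) \<le> B * (nrm f)\<^sup>2" if "f \<in> H" for f
    using bound that by (intro suminf_le_const) auto
  ultimately show ?thesis
    unfolding bessel_def using assms(1,2) by auto
qed

lemma bessel_H: "bessel u \<Longrightarrow> u n \<in> H"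
  by (simp add: bessel_def)

lemma bessel_in_l2: "bessel u \<Longrightarrow> f \<in> H \<Longrightarrow> in_l2 (\<lambda>n. ip f (u n))"
  by (auto simp: bessel_def in_l2_def)

lemma sums_ip:
  assumes "series_to c u h" "\<And>n. u n \<in> H" "h \<in> H" "f \<in> H"
  shows "(\<lambda>n. c n * ip (u n) f) sums ip h f"
proof -
  have "(\<lambda>N. ip (\<Sum>n<N. c n \<odot> u n) f) \<longlonglongrightarrow> ip h f"
    using assms unfolding series_to_def by (intro tendsto_ip) auto
  then show ?thesis
    unfolding sums_def using assms by (simp add: ip_sum ip_scale)
qed

text \<open>
  For a finite partial sum \<open>s\<close>, expanding \<open>ip s s\<close> and applying the Cauchy-Schwarz inequality and
  the Bessel bound to \<open>s\<close> itself gives \<open>(nrm s)\<^sup>2 \<le> B * \<Sum> (cmod (c i))\<^sup>2\<close>; hence the tails of the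
  series are controlled by the tails of \<open>c\<close> in \<open>l\<^sup>2\<close>.
\<close>

lemma bessel_series_converges:
  assumes u: "bessel u" and c: "in_l2 c"
  shows "\<exists>h\<in>H. series_to c u h"
proof -
  obtain B where B: "0 < B"
      "\<And>f. f \<in> H \<Longrightarrow> summable (\<lambda>n. (cmod (ip f (u n)))\<^sup>2)"
      "\<And>f. f \<in> H \<Longrightarrow> (\<Sum>n. (cmod (ip f (u n)))\<^sup>2) \<le> B * (nrm f)\<^sup>2"
    using u by (auto simp: bessel_def)
  have uH [simp]: "u n \<in> H" for n using u by (rule bessel_H)
  have finite_bound: "(nrm (\<Sum>i\<in>I. c i \<odot> u i))\<^sup>2 \<le> B * (\<Sum>i\<in>I. (cmod (c i))\<^sup>2)"
    if "finite I" for I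
  proof -
    define s where "s = (\<Sum>i\<in>I. c i \<odot> u i)"
    have s: "s \<in> H" unfolding s_def by (intro sum_H) auto
    have "(nrm s)\<^sup>2 = cmod (ip s s)" using s by (simp add: ip_self norm_power)
    also have "ip s s = (\<Sum>i\<in>I. c i * ip (u i) s)"
      using s by (subst s_def) (simp add: ip_sum ip_scale)
    also have "cmod \<dots> \<le> (\<Sum>i\<in>I. cmod (c i) * cmod (ip s (u i)))"
      using s by (intro sum_norm_le) (simp add: norm_mult ip_cnj[of s "u _"])
    finally have "((nrm s)\<^sup>2)\<^sup>2 \<le> (\<Sum>i\<in>I. cmod (c i) * cmod (ip s (u i)))\<^sup>2"
      by (intro power_mono) auto
    also have "\<dots> \<le> (\<Sum>i\<in>I. (cmod (c i))\<^sup>2) * (\<Sum>i\<in>I. (cmod (ip s (u i)))\<^sup>2)"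
      by (rule Cauchy_Schwarz_ineq_sum)
    also have "\<dots> \<le> (\<Sum>i\<in>I. (cmod (c i))\<^sup>2) * (B * (nrm s)\<^sup>2)"
      using sum_le_suminf[OF B(2)[OF s] that] B(3)[OF s]
      by (intro mult_left_mono sum_nonneg) auto
    finally have "(nrm s)\<^sup>2 * (nrm s)\<^sup>2 \<le> (B * (\<Sum>i\<in>I. (cmod (c i))\<^sup>2)) * (nrm s)\<^sup>2"
      by (simp add: power2_eq_square mult_ac)
    moreover have "0 \<le> B * (\<Sum>i\<in>I. (cmod (c i))\<^sup>2)"
      using B(1) by (intro mult_nonneg_nonneg sum_nonneg) auto
    ultimately have "(nrm s)\<^sup>2 \<le> B * (\<Sum>i\<in>I. (cmod (c i))\<^sup>2)"
      by (cases "nrm s = 0") (simp_all only: mult_le_cancel_right zero_power2 zero_less_power2, simp_all)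
    then show ?thesis by (simp add: s_def)
  qed
  define X where "X N = (\<Sum>n<N. c n \<odot> u n)" for N
  define \<sigma> where "\<sigma> = (\<Sum>n. (cmod (c n))\<^sup>2)"
  define a where "a N = sqrt (B * (\<sigma> - (\<Sum>n<N. (cmod (c n))\<^sup>2)))" for N
  have summ: "summable (\<lambda>n. (cmod (c n))\<^sup>2)" using c by (simp add: in_l2_def)
  have XH: "X N \<in> H" for N unfolding X_def by (intro sum_H) auto
  have "nrm (X m - X n) \<le> a n" if "n \<le> m" for m n
  proof -
    have "X m - X n = (\<Sum>i\<in>{n..<m}. c i \<odot> u i)"
      using sum_diff_nat_ivl[of 0 n m "\<lambda>i. c i \<odot> u i"] that
      by (simp add: X_def atLeast0LessThan)
    moreover have "(\<Sum>i\<in>{n..<m}. (cmod (c i))\<^sup>2) \<le> \<sigma> - (\<Sum>i<n. (cmod (c i))\<^sup>2)"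
      using sum_diff_nat_ivl[of 0 n m "\<lambda>i. (cmod (c i))\<^sup>2"] that
        sum_le_suminf[OF summ, of "{..<m}"] by (simp add: \<sigma>_def atLeast0LessThan)
    then have "B * (\<Sum>i\<in>{n..<m}. (cmod (c i))\<^sup>2) \<le> B * (\<sigma> - (\<Sum>i<n. (cmod (c i))\<^sup>2))"
      using B(1) by (intro mult_left_mono) auto
    ultimately have "(nrm (X m - X n))\<^sup>2 \<le> B * (\<sigma> - (\<Sum>i<n. (cmod (c i))\<^sup>2))"
      using finite_bound[of "{n..<m}"] by simp
    then show ?thesis unfolding a_def by (rule real_le_rsqrt)
  qed
  moreover have "a \<longlonglongrightarrow> 0"
  proof -
    have "(\<lambda>N. \<Sum>n<N. (cmod (c n))\<^sup>2) \<longlonglongrightarrow> \<sigma>"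
      unfolding \<sigma>_def using summ by (rule summable_LIMSEQ)
    then have "a \<longlonglongrightarrow> sqrt (B * (\<sigma> - \<sigma>))" unfolding a_def by (intro tendsto_intros)
    then show ?thesis by simp
  qed
  ultimately show ?thesis
    using convergent_if_cauchy_bound[of X a] XH unfolding series_to_def X_def by blast
qed

text \<open>
  Uniform boundedness for the seminorms given by the \<open>l\<^sup>2\<close> norm of the first \<open>N\<close> coefficients.
\<close>

lemma bessel_if_coefficients_l2:
  assumes u: "\<And>n. u n \<in> H" and l2: "\<And>f. f \<in> H \<Longrightarrow> summable (\<lambda>n. (cmod (ip f (u n)))\<^sup>2)"
  shows "bessel u"
proof -
  define p where "p N f = L2_set (\<lambda>n. cmod (ip f (u n))) {..<N}" for N f
  have "\<exists>M>0. \<forall>f\<in>H. \<forall>N. p N f \<le> M * nrm f"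
  proof (rule uniform_boundedness)
    fix N f g assume fg: "f \<in> H" "g \<in> H"
    have "p N (f + g) \<le> L2_set (\<lambda>n. cmod (ip f (u n)) + cmod (ip g (u n))) {..<N}"
      unfolding p_def using fg u by (intro L2_set_mono) (auto simp: ip_add norm_triangle_ineq)
    also have "\<dots> \<le> p N f + p N g" unfolding p_def by (rule L2_set_triangle_ineq)
    finally show "p N (f + g) \<le> p N f + p N g" .
  next
    fix N c f assume "f \<in> H"
    then show "p N (c \<odot> f) = cmod c * p N f"
      unfolding p_def using u by (simp add: ip_scale norm_mult L2_set_right_distrib)
  next
    fix N f assume f: "f \<in> H"
    have "p N f \<le> (\<Sum>n<N. cmod (ip f (u n)))" unfolding p_def by (rule L2_set_le_sum) simp
    also have "\<dots> \<le> (\<Sum>n<N. nrm f * nrm (u n))"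
      using cauchy_schwarz f u by (intro sum_mono) auto
    finally show "p N f \<le> (\<Sum>n<N. nrm (u n)) * nrm f"
      by (simp add: sum_distrib_left mult.commute)
  next
    fix f assume f: "f \<in> H"
    have "p N f \<le> sqrt (\<Sum>n. (cmod (ip f (u n)))\<^sup>2)" for N
      unfolding p_def L2_set_def using l2[OF f] by (intro real_sqrt_le_mono sum_le_suminf) auto
    then show "\<exists>C. \<forall>N. p N f \<le> C" by blast
  qed
  then obtain M where M: "0 < M" "\<And>f N. f \<in> H \<Longrightarrow> p N f \<le> M * nrm f" by blast
  show ?thesis
  proof (rule besselI)
    fix f N assume "f \<in> H"
    then have "(p N f)\<^sup>2 \<le> (M * nrm f)\<^sup>2"
      using M(2) by (intro power_mono) (auto simp: p_def)
    then show "(\<Sum>n<N. (cmod (ip f (u n)))\<^sup>2) \<le> M\<^sup>2 * (nrm f)\<^sup>2"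
      by (simp add: p_def L2_set_def sum_nonneg power_mult_distrib)
  qed (use u M(1) in auto)
qed

definition bounded_op :: "('v \<Rightarrow> 'v) \<Rightarrow> bool" where
  "bounded_op L \<longleftrightarrow> (\<forall>f\<in>H. L f \<in> H) \<and> (\<forall>f\<in>H. \<forall>g\<in>H. L (f + g) = L f + L g) \<and>
     (\<forall>c. \<forall>f\<in>H. L (c \<odot> f) = c \<odot> L f) \<and> (\<exists>C. \<forall>f\<in>H. nrm (L f) \<le> C * nrm f)"

definition adj :: "('v \<Rightarrow> 'v) \<Rightarrow> 'v \<Rightarrow> 'v" where
  "adj L g = (THE h. h \<in> H \<and> (\<forall>f\<in>H. ip (L f) g = ip f h))"

lemma adj:
  assumes L: "bounded_op L" and g: "g \<in> H"
  shows adj_H: "adj L g \<in> H" and ip_adj: "\<And>f. f \<in> H \<Longrightarrow> ip (L f) g = ip f (adj L g)"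
proof -
  obtain C where C: "\<And>f. f \<in> H \<Longrightarrow> nrm (L f) \<le> C * nrm f"
    using L unfolding bounded_op_def by blast
  have LH: "L f \<in> H" if "f \<in> H" for f using L that by (simp add: bounded_op_def)
  have "\<exists>h\<in>H. \<forall>f\<in>H. ip (L f) g = ip f h"
  proof (rule riesz)
    fix f assume f: "f \<in> H"
    have "cmod (ip (L f) g) \<le> nrm (L f) * nrm g" using LH f g by (intro cauchy_schwarz)
    also have "\<dots> \<le> (C * nrm f) * nrm g" using C[OF f] g by (intro mult_right_mono) auto
    finally show "cmod (ip (L f) g) \<le> (C * nrm g) * nrm f" by (simp add: mult_ac)
  qed (use L LH g in \<open>simp_all add: bounded_op_def ip_add ip_scale\<close>)
  then obtain h where h: "h \<in> H" "\<And>f. f \<in> H \<Longrightarrow> ip (L f) g = ip f h" by blast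
  have "adj L g = h"
    unfolding adj_def using h by (intro the_equality) (auto intro: eq_if_ip_eq)
  with h show "adj L g \<in> H" "\<And>f. f \<in> H \<Longrightarrow> ip (L f) g = ip f (adj L g)"
    by simp_all
qed

text \<open>
  Expanding \<open>ip (L f) h\<close> with the series for \<open>L f\<close> shows that \<open>L' h\<close> has the same inner products as
  the sum of the series with the roles of \<open>u\<close> and \<open>g\<close> exchanged, which exists because \<open>g\<close> is Bessel.
\<close>

lemma series_adjoint:
  assumes u: "bessel u" and g: "bessel g"
    and H: "\<And>f. f \<in> H \<Longrightarrow> L f \<in> H" "\<And>f. f \<in> H \<Longrightarrow> L' f \<in> H"
    and adjoint: "\<And>f h. \<lbrakk>f \<in> H; h \<in> H\<rbrakk> \<Longrightarrow> ip (L f) h = ip f (L' h)"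
    and series: "\<And>f. f \<in> H \<Longrightarrow> series_to (\<lambda>n. ip f (g n)) u (L f)"
    and h: "h \<in> H"
  shows "series_to (\<lambda>n. ip h (u n)) g (L' h)"
proof -
  have uH: "u n \<in> H" and gH: "g n \<in> H" for n using u g bessel_H by auto
  obtain h' where h': "h' \<in> H" "series_to (\<lambda>n. ip h (u n)) g h'"
    using bessel_series_converges[OF g bessel_in_l2[OF u h]] by blast
  have "h' = L' h"
  proof (rule eq_if_ip_eq)
    fix f assume f: "f \<in> H"
    have "(\<lambda>n. cnj (ip h (u n) * ip (g n) f)) sums cnj (ip h' f)"
      using sums_ip[OF h'(2) gH h'(1) f] by (simp only: sums_cnj)
    then have "(\<lambda>n. ip f (g n) * ip (u n) h) sums ip f h'"
      using f h h'(1) uH gH ip_cnj[of h' f] ip_cnj[of h "u _"] ip_cnj[of "g _" f]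
      by (simp add: mult.commute)
    moreover have "(\<lambda>n. ip f (g n) * ip (u n) h) sums ip (L f) h"
      using series f h uH H by (intro sums_ip) auto
    ultimately show "ip f h' = ip f (L' h)"
      using adjoint[OF f h] sums_unique2 by simp
  qed (use h h' H in auto)
  with h' show ?thesis by simp
qed

end


section \<open>The Hilbert space of square-summable sequences\<close>

definition l2_ip :: "(nat \<Rightarrow> complex) \<Rightarrow> (nat \<Rightarrow> complex) \<Rightarrow> complex" where
  "l2_ip a b = (\<Sum>n. a n * cnj (b n))"

lemma summable_l2_ip:
  assumes "in_l2 a" "in_l2 b"
  shows "summable (\<lambda>n. a n * cnj (b n))"
proof (rule summable_comparison_test')
  show "summable (\<lambda>n. (cmod (a n))\<^sup>2 + (cmod (b n))\<^sup>2)"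
    using assms by (simp add: in_l2_def summable_add)
  show "norm (a n * cnj (b n)) \<le> (cmod (a n))\<^sup>2 + (cmod (b n))\<^sup>2" for n
    using sum_squares_bound[of "cmod (a n)" "cmod (b n)"]
      mult_nonneg_nonneg[OF norm_ge_zero norm_ge_zero, of "a n" "b n"]
    unfolding norm_mult complex_mod_cnj by linarith
qed

lemma in_l2_add:
  assumes "in_l2 a" "in_l2 b"
  shows "in_l2 (a + b)"
  unfolding in_l2_def
proof (rule summable_comparison_test')
  show "summable (\<lambda>n. 2 * (cmod (a n))\<^sup>2 + 2 * (cmod (b n))\<^sup>2)"
    using assms by (intro summable_add summable_mult) (auto simp: in_l2_def)
  show "norm ((cmod ((a + b) n))\<^sup>2) \<le> 2 * (cmod (a n))\<^sup>2 + 2 * (cmod (b n))\<^sup>2" for n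
  proof -
    have "(cmod (a n + b n))\<^sup>2 \<le> (cmod (a n) + cmod (b n))\<^sup>2"
      by (intro power_mono norm_triangle_ineq) simp
    moreover have "0 \<le> (cmod (a n) - cmod (b n))\<^sup>2" by simp
    ultimately show ?thesis by (simp add: power2_sum power2_diff)
  qed
qed

lemma in_l2_scale: "in_l2 a \<Longrightarrow> in_l2 (\<lambda>n. c * a n)"
  by (simp add: in_l2_def norm_mult power_mult_distrib summable_mult)

lemma l2_ip_self: "in_l2 a \<Longrightarrow> l2_ip a a = of_real (\<Sum>n. (cmod (a n))\<^sup>2)"
  unfolding l2_ip_def by (simp add: in_l2_def suminf_of_real complex_norm_square[symmetric])

lemma vector_space_fun: "vector_space (\<lambda>c f x. c * f x :: complex)"
  by standard (auto simp: fun_eq_iff algebra_simps)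

interpretation l2: semi_inner_space "\<lambda>c f n. c * f n" "{a. in_l2 a}" l2_ip
proof (intro semi_inner_space.intro vector_space_fun semi_inner_space_axioms.intro)
  interpret vector_space "\<lambda>c f n. c * f n :: complex" by (rule vector_space_fun)
  show "subspace {a :: nat \<Rightarrow> complex. in_l2 a}"
    by (rule subspaceI) (auto simp: in_l2_add in_l2_scale, simp add: in_l2_def)
next
  fix a b d :: "nat \<Rightarrow> complex" assume "a \<in> {a. in_l2 a}" "b \<in> {a. in_l2 a}" "d \<in> {a. in_l2 a}"
  then show "l2_ip (a + b) d = l2_ip a d + l2_ip b d"
    unfolding l2_ip_def using suminf_add[OF summable_l2_ip[of a d] summable_l2_ip[of b d]]
    by (simp add: distrib_right)
next
  fix a b :: "nat \<Rightarrow> complex" and c assume ab: "a \<in> {a. in_l2 a}" "b \<in> {a. in_l2 a}"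
  show "l2_ip (\<lambda>n. c * a n) b = c * l2_ip a b"
    unfolding l2_ip_def using ab suminf_mult[OF summable_l2_ip[of a b], of c]
    by (simp add: mult.assoc)
  show "l2_ip b a = cnj (l2_ip a b)"
  proof -
    have "(\<lambda>n. a n * cnj (b n)) sums l2_ip a b"
      unfolding l2_ip_def using ab by (intro summable_sums summable_l2_ip) auto
    then have "(\<lambda>n. cnj (a n * cnj (b n))) sums cnj (l2_ip a b)"
      by (simp only: sums_cnj)
    then have "(\<lambda>n. b n * cnj (a n)) sums cnj (l2_ip a b)" by (simp add: mult.commute)
    then show ?thesis unfolding l2_ip_def[of b a] by (rule sums_unique[symmetric])
  qed
next
  fix a :: "nat \<Rightarrow> complex" assume "a \<in> {a. in_l2 a}"
  then show "0 \<le> Re (l2_ip a a)"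
    by (simp add: l2_ip_self) (simp add: in_l2_def suminf_nonneg)
qed

lemma l2_nrm: "in_l2 a \<Longrightarrow> l2.nrm a = l2_norm a"
  by (simp add: l2.nrm_def l2_ip_self l2_norm_def)

lemma l2_norm_sq: "in_l2 a \<Longrightarrow> (l2_norm a)\<^sup>2 = (\<Sum>n. (cmod (a n))\<^sup>2)"
  by (simp add: l2_norm_def in_l2_def suminf_nonneg)

lemma sum_le_l2_norm:
  assumes "in_l2 a" "finite I"
  shows "(\<Sum>n\<in>I. (cmod (a n))\<^sup>2) \<le> (l2_norm a)\<^sup>2"
  unfolding l2_norm_sq[OF assms(1)] using assms by (intro sum_le_suminf) (auto simp: in_l2_def)

lemma coordinate_le_l2_norm:
  assumes "in_l2 a"
  shows "cmod (a n) \<le> l2_norm a"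
proof -
  have "(cmod (a n))\<^sup>2 \<le> (l2_norm a)\<^sup>2" using sum_le_l2_norm[OF assms, of "{n}"] by simp
  moreover have "0 \<le> l2_norm a" using assms by (simp add: l2_nrm[symmetric])
  ultimately show ?thesis by (simp add: power2_le_iff_abs_le)
qed

lemma in_l2I:
  assumes "0 \<le> C" "\<And>N. (\<Sum>n<N. (cmod (a n))\<^sup>2) \<le> C\<^sup>2"
  shows "in_l2 a \<and> l2_norm a \<le> C"
proof -
  have "summable (\<lambda>n. (cmod (a n))\<^sup>2)"
    by (rule summableI_nonneg_bounded[OF _ assms(2)]) simp
  moreover from this have "(\<Sum>n. (cmod (a n))\<^sup>2) \<le> C\<^sup>2"
    using assms(2) by (intro suminf_le_const) auto
  ultimately show ?thesis using assms(1) by (simp add: in_l2_def l2_norm_def real_le_lsqrt suminf_nonneg)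
qed

text \<open>
  Completeness: the coordinates converge, and the bound on each finite partial sum of
  \<open>(cmod (X m k - X n k))\<^sup>2\<close> survives the limit in \<open>n\<close>.
\<close>

interpretation l2: hilbert_space "\<lambda>c f n. c * f n" "{a. in_l2 a}" l2_ip
proof (intro hilbert_space.intro l2.semi_inner_space_axioms hilbert_space_axioms.intro)
  fix a :: "nat \<Rightarrow> complex" assume "a \<in> {a. in_l2 a}" "l2.nrm a = 0"
  then have "cmod (a n) \<le> 0" for n using coordinate_le_l2_norm[of a n] by (simp add: l2_nrm)
  then show "a = 0" by (auto simp: fun_eq_iff)
next
  fix X :: "nat \<Rightarrow> nat \<Rightarrow> complex"
  assume X: "\<And>n. X n \<in> {a. in_l2 a}"
    and cauchy: "\<And>e. 0 < e \<Longrightarrow> \<exists>M. \<forall>m\<ge>M. \<forall>n\<ge>M. l2.nrm (X m - X n) < e"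
  have diff: "in_l2 (X m - X n)" for m n using l2.diff_H[OF X X] by simp
  have "Cauchy (\<lambda>m. X m k)" for k
  proof (rule CauchyI)
    fix e :: real assume "0 < e"
    then obtain M where M: "\<And>m n. m \<ge> M \<Longrightarrow> n \<ge> M \<Longrightarrow> l2.nrm (X m - X n) < e"
      using cauchy by blast
    have "cmod (X m k - X n k) < e" if "m \<ge> M" "n \<ge> M" for m n
      using coordinate_le_l2_norm[OF diff[of m n], of k] M[OF that] l2_nrm[OF diff[of m n]] by simp
    then show "\<exists>M. \<forall>m\<ge>M. \<forall>n\<ge>M. norm (X m k - X n k) < e" by blast
  qed
  then obtain x where x: "\<And>k. (\<lambda>m. X m k) \<longlonglongrightarrow> x k"
    unfolding Cauchy_convergent_iff convergent_def by metis
  have close: "\<exists>M. \<forall>m\<ge>M. in_l2 (X m - x) \<and> l2_norm (X m - x) \<le> e" if e: "0 < e" for e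
  proof -
    obtain M where M: "\<forall>m\<ge>M. \<forall>n\<ge>M. l2.nrm (X m - X n) < e" using cauchy[OF e] by blast
    have "in_l2 (X m - x) \<and> l2_norm (X m - x) \<le> e" if m: "m \<ge> M" for m
    proof (rule in_l2I)
      fix K
      have "(\<Sum>k<K. (cmod ((X m - X n) k))\<^sup>2) \<le> e\<^sup>2" if "n \<ge> M" for n
      proof -
        have "l2_norm (X m - X n) < e" using M m that by (simp add: l2_nrm diff)
        then have "(l2_norm (X m - X n))\<^sup>2 \<le> e\<^sup>2"
          using l2.nrm_nonneg[OF l2.diff_H[OF X X]] by (intro power_mono) (auto simp: l2_nrm diff)
        then show ?thesis using sum_le_l2_norm[OF diff, of "{..<K}" m n] by simp
      qed
      moreover have "(\<lambda>n. \<Sum>k<K. (cmod ((X m - X n) k))\<^sup>2) \<longlonglongrightarrow> (\<Sum>k<K. (cmod ((X m - x) k))\<^sup>2)"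
        using x by (auto intro!: tendsto_intros)
      ultimately show "(\<Sum>k<K. (cmod ((X m - x) k))\<^sup>2) \<le> e\<^sup>2"
        by (intro LIMSEQ_le_const2) auto
    qed (use e in simp)
    then show ?thesis by blast
  qed
  obtain M where "in_l2 (X M - x)" using close[of 1] by auto
  then have x_l2: "x \<in> {a. in_l2 a}"
    using l2.diff_H[OF X, of "X M - x" M] by simp
  moreover have "l2.converges_to X x"
    unfolding l2.converges_to_def
  proof (rule LIMSEQ_I)
    fix e :: real assume "0 < e"
    then obtain M where "\<forall>m\<ge>M. in_l2 (X m - x) \<and> l2_norm (X m - x) \<le> e / 2"
      using close[of "e / 2"] by auto
    then have "norm (l2.nrm (X m - x) - 0) < e" if "m \<ge> M" for m
      using that \<open>0 < e\<close> l2.nrm_nonneg[OF l2.diff_H[OF X x_l2], of m] by (auto simp: l2_nrm)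
    then show "\<exists>M. \<forall>m\<ge>M. norm (l2.nrm (X m - x) - 0) < e" by blast
  qed
  ultimately show "\<exists>x\<in>{a. in_l2 a}. l2.converges_to X x" by blast
qed

section \<open>Atomic systems in a Hilbert space\<close>

context hilbert_space begin

text \<open>
  Here uniform boundedness is applied on \<open>l\<^sup>2\<close>, to the norms of the partial sums: they are bounded by
  \<open>M\<close> times the norm of the coefficients.  Testing this with the truncated coefficient
  sequence of \<open>f\<close> itself gives \<open>\<sigma> \<le> M * sqrt \<sigma> * nrm f\<close> for the partial sums \<open>\<sigma>\<close> in the Bessel
  inequality.
\<close>

lemma bessel_if_series_converge:
  assumes u: "\<And>n. u n \<in> H" and conv: "\<And>c. in_l2 c \<Longrightarrow> \<exists>h\<in>H. series_to c u h"
  shows "bessel u"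
proof -
  define p where "p N c = nrm (\<Sum>n<N. c n \<odot> u n)" for N and c :: "nat \<Rightarrow> complex"
  have sH: "(\<Sum>n<N. c n \<odot> u n) \<in> H" for N and c :: "nat \<Rightarrow> complex"
    using u by (intro sum_H) auto
  have "\<exists>M>0. \<forall>c\<in>{c. in_l2 c}. \<forall>N. p N c \<le> M * l2.nrm c"
  proof (rule l2.uniform_boundedness)
    fix N and c d :: "nat \<Rightarrow> complex"
    show "p N (c + d) \<le> p N c + p N d"
      unfolding p_def using nrm_triangle[OF sH sH]
      by (simp add: scale_left_distrib sum.distrib)
  next
    fix N a and c :: "nat \<Rightarrow> complex"
    have "(\<Sum>n<N. (a * c n) \<odot> u n) = a \<odot> (\<Sum>n<N. c n \<odot> u n)" by (simp add: scale_sum_right)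
    then show "p N (\<lambda>n. a * c n) = cmod a * p N c"
      unfolding p_def using nrm_scale[OF sH] by simp
  next
    fix N and c :: "nat \<Rightarrow> complex" assume c: "c \<in> {c. in_l2 c}"
    have "p N c \<le> (\<Sum>n<N. nrm (c n \<odot> u n))"
      unfolding p_def
    proof (induction N)
      case (Suc N)
      then show ?case using nrm_triangle[OF sH[of c N] scale_H[OF u], of "c N" N] by simp
    qed simp
    also have "\<dots> \<le> (\<Sum>n<N. l2_norm c * nrm (u n))"
      using c u coordinate_le_l2_norm[of c]
      by (intro sum_mono) (auto simp: nrm_scale intro: mult_right_mono)
    finally show "p N c \<le> (\<Sum>n<N. nrm (u n)) * l2.nrm c"
      using c by (simp add: sum_distrib_left l2_nrm mult.commute)
  next
    fix c :: "nat \<Rightarrow> complex" assume "c \<in> {c. in_l2 c}"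
    then obtain h where "h \<in> H" "series_to c u h" using conv by blast
    then have "(\<lambda>N. p N c) \<longlonglongrightarrow> nrm h"
      unfolding p_def series_to_def using sH by (intro tendsto_nrm) auto
    then have "Bseq (\<lambda>N. p N c)" using convergent_imp_Bseq convergent_def by blast
    then show "\<exists>C. \<forall>N. p N c \<le> C" by (auto simp: Bseq_def intro: order_trans[OF abs_ge_self])
  qed
  then obtain M where M: "0 < M" "\<And>c N. in_l2 c \<Longrightarrow> p N c \<le> M * l2.nrm c" by blast
  show ?thesis
  proof (rule besselI)
    fix f N assume f: "f \<in> H"
    define c where "c n = (if n < N then ip f (u n) else 0)" for n
    define \<sigma> where "\<sigma> = (\<Sum>n<N. (cmod (ip f (u n)))\<^sup>2)"
    have \<sigma>: "0 \<le> \<sigma>" by (simp add: \<sigma>_def sum_nonneg)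
    have "(\<lambda>n. (cmod (c n))\<^sup>2) sums (\<Sum>n<N. (cmod (c n))\<^sup>2)"
      by (rule sums_finite) (auto simp: c_def)
    then have c: "in_l2 c" "l2_norm c = sqrt \<sigma>"
      by (auto simp: in_l2_def l2_norm_def \<sigma>_def c_def sums_iff)
    let ?s = "\<Sum>n<N. c n \<odot> u n"
    have "ip ?s f = (\<Sum>n<N. ip f (u n) * cnj (ip f (u n)))"
      using f u ip_cnj[OF f u] by (simp add: ip_sum ip_scale c_def)
    also have "\<dots> = of_real \<sigma>"
      unfolding \<sigma>_def of_real_sum complex_norm_square ..
    finally have "\<sigma> = cmod (ip ?s f)" using \<sigma> by simp
    also have "\<dots> \<le> nrm ?s * nrm f" using sH f by (rule cauchy_schwarz)
    also have "\<dots> \<le> (M * sqrt \<sigma>) * nrm f"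
      using M(2)[OF c(1), of N] f c by (intro mult_right_mono) (auto simp: p_def l2_nrm)
    finally have le: "sqrt \<sigma> * sqrt \<sigma> \<le> sqrt \<sigma> * (M * nrm f)" using \<sigma> by (simp add: mult_ac)
    have "sqrt \<sigma> \<le> M * nrm f"
    proof (cases "\<sigma> = 0")
      case False
      then show ?thesis using \<sigma> by (intro mult_left_le_imp_le[OF le]) simp
    qed (use f M(1) in simp)
    then have "(sqrt \<sigma>)\<^sup>2 \<le> (M * nrm f)\<^sup>2" using \<sigma> by (intro power_mono) auto
    then show "(\<Sum>n<N. (cmod (ip f (u n)))\<^sup>2) \<le> M\<^sup>2 * (nrm f)\<^sup>2"
      using \<sigma> by (simp add: \<sigma>_def power_mult_distrib)
  qed (use u M(1) in auto)
qed

text \<open>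
  The nontrivial half of Douglas' factorization lemma.  The hypothesis says that \<open>T h\<close>
  dominates \<open>adj L h\<close>, hence \<open>cmod (ip h (L f)) \<le> nrm f / sqrt A * l2.nrm (T h)\<close>.  So \<open>ip h (L f)\<close>
  depends on \<open>T h\<close> only and is a bounded functional of it; representing this functional in the
  closure of the range of \<open>T\<close> gives a coefficient sequence \<open>b f\<close> for \<open>L f\<close>.  Uniqueness
  inside that closure makes \<open>b\<close> linear, and Riesz representation of its coordinates yields \<open>g\<close>.
\<close>

lemma factorization_if_lower_bound:
  assumes u: "bessel u" and L: "bounded_op L" and A: "0 < A"
    and lower: "\<And>f. f \<in> H \<Longrightarrow> A * (nrm (adj L f))\<^sup>2 \<le> (\<Sum>n. (cmod (ip f (u n)))\<^sup>2)"
  shows "\<exists>g. bessel g \<and> (\<forall>f\<in>H. series_to (\<lambda>n. ip f (g n)) u (L f))"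
proof -
  define T where "T h = (\<lambda>n. ip h (u n))" for h
  define S where "S = T ` H"
  have uH: "u n \<in> H" for n using u by (rule bessel_H)
  have LH: "L f \<in> H" if "f \<in> H" for f using L that by (simp add: bounded_op_def)
  have T_l2: "in_l2 (T h)" if "h \<in> H" for h unfolding T_def using u that by (rule bessel_in_l2)
  have T_add: "T (h + h') = T h + T h'" if "h \<in> H" "h' \<in> H" for h h'
    using that uH by (simp add: T_def ip_add fun_eq_iff)
  have T_scale: "T (c \<odot> h) = (\<lambda>n. c * T h n)" if "h \<in> H" for c h
    using that uH by (simp add: T_def ip_scale)
  have S: "S \<subseteq> {a. in_l2 a}" using T_l2 by (auto simp: S_def)
  have subS: "l2.subspace S"
  proof (rule l2.subspaceI)
    have "T 0 = 0" using uH by (simp add: T_def fun_eq_iff)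
    then show "0 \<in> S" unfolding S_def by (intro image_eqI[of _ _ 0]) simp_all
  next
    fix a b assume "a \<in> S" "b \<in> S"
    then obtain h h' where h: "h \<in> H" "h' \<in> H" "a = T h" "b = T h'" by (auto simp: S_def)
    then show "a + b \<in> S" unfolding S_def by (intro image_eqI[of _ _ "h + h'"]) (simp_all add: T_add)
  next
    fix c a assume "a \<in> S"
    then obtain h where h: "h \<in> H" "a = T h" by (auto simp: S_def)
    then show "(\<lambda>n. c * a n) \<in> S" unfolding S_def by (intro image_eqI[of _ _ "c \<odot> h"]) (simp_all add: T_scale)
  qed
  have bound: "cmod (ip h (L f)) \<le> nrm f / sqrt A * l2.nrm (T h)" if h: "h \<in> H" and f: "f \<in> H" for h f
  proof -
    have "A * (nrm (adj L h))\<^sup>2 \<le> (l2_norm (T h))\<^sup>2"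
      using lower[OF h] l2_norm_sq[OF T_l2[OF h]] by (simp add: T_def)
    then have "(sqrt A * nrm (adj L h))\<^sup>2 \<le> (l2.nrm (T h))\<^sup>2"
      using A T_l2[OF h] by (simp add: power_mult_distrib l2_nrm)
    then have "sqrt A * nrm (adj L h) \<le> l2.nrm (T h)"
      by (rule power2_le_imp_le) (use T_l2[OF h] in simp)
    then have *: "nrm (adj L h) \<le> l2.nrm (T h) / sqrt A"
      using A by (simp add: field_simps)
    have "cmod (ip h (L f)) = cmod (ip f (adj L h))"
      using ip_cnj[OF LH[OF f] h] ip_adj[OF L h f] by simp
    also have "\<dots> \<le> nrm f * nrm (adj L h)" using f adj_H[OF L h] by (rule cauchy_schwarz)
    also have "\<dots> \<le> nrm f * (l2.nrm (T h) / sqrt A)" using * f by (intro mult_left_mono) auto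
    finally show ?thesis by simp
  qed
  have rep: "\<exists>b. b \<in> l2.lim_set S \<and> (\<forall>h\<in>H. ip h (L f) = l2_ip (T h) b) \<and> l2.nrm b \<le> nrm f / sqrt A"
    if f: "f \<in> H" for f
  proof -
    \<comment> \<open>the choice of the preimage is immaterial: \<open>bound\<close> makes the value vanish when \<open>T\<close> does\<close>
    define \<phi> where "\<phi> a = ip (SOME h. h \<in> H \<and> T h = a) (L f)" for a
    have \<phi>: "\<phi> (T h) = ip h (L f)" if h: "h \<in> H" for h
    proof -
      define h' where "h' = (SOME h'. h' \<in> H \<and> T h' = T h)"
      have h': "h' \<in> H" "T h' = T h"
        using someI[of "\<lambda>h'. h' \<in> H \<and> T h' = T h" h] h by (auto simp: h'_def)
      have "T (h' - h) = 0" using h h' uH by (simp add: T_def ip_diff fun_eq_iff)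
      then have "ip (h' - h) (L f) = 0"
        using bound[of "h' - h" f] h h'(1) f by (simp add: l2.nrm_zero)
      then show ?thesis using h h' f LH by (simp add: \<phi>_def h'_def[symmetric] ip_diff)
    qed
    have "\<exists>b\<in>l2.lim_set S. (\<forall>a\<in>S. \<phi> a = l2_ip a b) \<and> l2.nrm b \<le> nrm f / sqrt A"
    proof (rule l2.riesz_subspace[OF subS S])
      fix a b assume "a \<in> S" "b \<in> S"
      then obtain h h' where h: "h \<in> H" "h' \<in> H" "a = T h" "b = T h'" by (auto simp: S_def)
      then show "\<phi> (a + b) = \<phi> a + \<phi> b"
        using f LH by (simp only: T_add[symmetric] \<phi> ip_add add_H)
    next
      fix c a assume "a \<in> S"
      then obtain h where h: "h \<in> H" "a = T h" by (auto simp: S_def)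
      then show "\<phi> (\<lambda>n. c * a n) = c * \<phi> a"
        using f LH by (simp only: T_scale[symmetric] \<phi> ip_scale scale_H)
    next
      fix a assume "a \<in> S"
      then show "cmod (\<phi> a) \<le> nrm f / sqrt A * l2.nrm a"
        using bound f by (auto simp: S_def \<phi>)
    qed (use f A in simp)
    then show ?thesis using \<phi> by (auto simp: S_def)
  qed
  define b where "b f = (SOME b. b \<in> l2.lim_set S \<and> (\<forall>h\<in>H. ip h (L f) = l2_ip (T h) b) \<and>
      l2.nrm b \<le> nrm f / sqrt A)" for f
  have b: "b f \<in> l2.lim_set S" "\<And>h. h \<in> H \<Longrightarrow> ip h (L f) = l2_ip (T h) (b f)"
      "l2.nrm (b f) \<le> nrm f / sqrt A" if "f \<in> H" for f
    using someI_ex[OF rep[OF that]] unfolding b_def by blast+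
  have b_l2: "in_l2 (b f)" if "f \<in> H" for f using b(1)[OF that] by (simp add: l2.lim_set_def)
  have b_unique: "x = b f"
    if "f \<in> H" "x \<in> l2.lim_set S" "\<And>h. h \<in> H \<Longrightarrow> ip h (L f) = l2_ip (T h) x" for x f
  proof -
    have "x - b f = 0"
    proof (rule l2.lim_set_orthogonal_eq_0[OF S])
      show "x - b f \<in> l2.lim_set S"
        using that b by (intro l2.subspace_diff[OF l2.subspace_lim_set[OF subS S]]) auto
      fix y assume "y \<in> S"
      then obtain h where h: "h \<in> H" "y = T h" by (auto simp: S_def)
      then show "l2_ip y (x - b f) = 0"
        using that b(2)[OF that(1) h(1)] T_l2 b_l2 by (simp add: l2.ip_diff_right l2.lim_set_def)
    qed
    then show ?thesis by simp
  qed
  have b_add: "b (f + f') = b f + b f'" if "f \<in> H" "f' \<in> H" for f f'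
  proof (rule b_unique[symmetric])
    show "b f + b f' \<in> l2.lim_set S"
      using that b by (intro l2.subspace_add[OF l2.subspace_lim_set[OF subS S]]) auto
    fix h assume h: "h \<in> H"
    have "L (f + f') = L f + L f'" using L that by (simp add: bounded_op_def)
    then show "ip h (L (f + f')) = l2_ip (T h) (b f + b f')"
      using that h LH b(2) T_l2 b_l2 by (simp add: ip_add_right l2.ip_add_right)
  qed (use that in auto)
  have b_scale: "b (c \<odot> f) = (\<lambda>n. c * b f n)" if "f \<in> H" for c f
  proof (rule b_unique[symmetric])
    show "(\<lambda>n. c * b f n) \<in> l2.lim_set S"
      using that b by (intro l2.subspace_scale[OF l2.subspace_lim_set[OF subS S]]) auto
    fix h assume h: "h \<in> H"
    have "L (c \<odot> f) = c \<odot> L f" using L that by (simp add: bounded_op_def)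
    then show "ip h (L (c \<odot> f)) = l2_ip (T h) (\<lambda>n. c * b f n)"
      using that h LH b(2) T_l2 b_l2 by (simp add: ip_scale_right l2.ip_scale_right)
  qed (use that in auto)
  have "\<exists>g\<in>H. \<forall>f\<in>H. b f n = ip f g" for n
  proof (rule riesz)
    fix f assume f: "f \<in> H"
    show "cmod (b f n) \<le> (1 / sqrt A) * nrm f"
      using coordinate_le_l2_norm[OF b_l2[OF f], of n] b(3)[OF f] by (simp add: l2_nrm b_l2 f)
  qed (simp_all add: b_add b_scale)
  then obtain g where g: "\<And>n. g n \<in> H" "\<And>f n. f \<in> H \<Longrightarrow> ip f (g n) = b f n" by metis
  have "bessel g"
  proof (rule besselI)
    show "0 < 1 / A" using A by simp
    fix f N assume f: "f \<in> H"
    have "(l2_norm (b f))\<^sup>2 \<le> (nrm f / sqrt A)\<^sup>2"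
      using b(3)[OF f] l2.nrm_nonneg[of "b f"] b_l2[OF f] by (intro power_mono) (auto simp: l2_nrm)
    then show "(\<Sum>n<N. (cmod (ip f (g n)))\<^sup>2) \<le> 1 / A * (nrm f)\<^sup>2"
      using sum_le_l2_norm[OF b_l2[OF f], of "{..<N}"] A f by (simp add: g power_divide)
  qed (rule g)
  moreover have "series_to (\<lambda>n. ip f (g n)) u (L f)" if f: "f \<in> H" for f
  proof -
    obtain k where k: "k \<in> H" "series_to (b f) u k"
      using bessel_series_converges[OF u b_l2[OF f]] by blast
    have "k = L f"
    proof (rule eq_if_ip_eq)
      fix h assume h: "h \<in> H"
      have "(\<lambda>n. cnj (b f n * ip (u n) h)) sums cnj (ip k h)"
        using sums_ip[OF k(2) uH k(1) h] by (simp only: sums_cnj)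
      then have "(\<lambda>n. T h n * cnj (b f n)) sums ip h k"
        using h k(1) uH ip_cnj[of k h] ip_cnj[of "u _" h] by (simp add: T_def mult.commute)
      then show "ip h k = ip h (L f)"
        using b(2)[OF f h] by (simp add: l2_ip_def sums_iff)
    qed (use k f LH in auto)
    then show ?thesis using k f by (simp add: g)
  qed
  ultimately show ?thesis by blast
qed

theorem atomic_system_characterizations:
  assumes u: "\<And>n. u n \<in> H" and L: "bounded_op L"
  defines "i \<equiv> (\<forall>c. in_l2 c \<longrightarrow> (\<exists>h\<in>H. series_to c u h)) \<and>
      (\<exists>C>0. \<forall>f\<in>H. \<exists>a. in_l2 a \<and> l2_norm a \<le> C * nrm f \<and> series_to a u (L f))"
    and "ii \<equiv> (\<exists>A>0. \<exists>B>0. \<forall>f\<in>H. summable (\<lambda>n. (cmod (ip f (u n)))\<^sup>2) \<and>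
        A * (nrm (adj L f))\<^sup>2 \<le> (\<Sum>n. (cmod (ip f (u n)))\<^sup>2) \<and>
        (\<Sum>n. (cmod (ip f (u n)))\<^sup>2) \<le> B * (nrm f)\<^sup>2)"
    and "iii \<equiv> bessel u \<and>
        (\<exists>g. bessel g \<and> (\<forall>f\<in>H. series_to (\<lambda>n. ip f (g n)) u (L f)))"
    and "iv \<equiv> (\<forall>f\<in>H. summable (\<lambda>n. (cmod (ip f (u n)))\<^sup>2)) \<and>
        (\<exists>g. bessel g \<and> (\<forall>f\<in>H. series_to (\<lambda>n. ip f (u n)) g (adj L f)))"
  shows "(i \<longleftrightarrow> ii) \<and> (ii \<longleftrightarrow> iii) \<and> (iii \<longleftrightarrow> iv)"
proof -
  have LH: "L f \<in> H" if "f \<in> H" for f using L that by (simp add: bounded_op_def)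
  have i_ii: ii if *: i
  proof -
    have bu: "bessel u" using u * unfolding i_def by (intro bessel_if_series_converge) auto
    obtain C where C: "0 < C" "\<And>f. f \<in> H \<Longrightarrow>
        \<exists>a. in_l2 a \<and> l2_norm a \<le> C * nrm f \<and> series_to a u (L f)"
      using * unfolding i_def by blast
    have lower: "1 / C\<^sup>2 * (nrm (adj L f))\<^sup>2 \<le> (\<Sum>n. (cmod (ip f (u n)))\<^sup>2)" if f: "f \<in> H" for f
    proof -
      define h where "h = adj L f"
      have h: "h \<in> H" unfolding h_def using L f by (rule adj_H)
      obtain a where a: "in_l2 a" "l2_norm a \<le> C * nrm h" "series_to a u (L h)"
        using C(2)[OF h] by blast
      define t where "t = (\<lambda>n. ip f (u n))"
      have t: "in_l2 t" unfolding t_def using bu f by (rule bessel_in_l2)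
      have "(\<lambda>n. a n * cnj (t n)) sums ip (L h) f"
        using sums_ip[OF a(3) u LH[OF h] f] f u ip_cnj[OF f u] by (simp add: t_def)
      then have "l2_ip a t = ip (L h) f" by (simp add: l2_ip_def sums_iff)
      also have "\<dots> = ip h h" unfolding h_def using ip_adj[OF L f] h by (simp add: h_def)
      finally have "(nrm h)\<^sup>2 = cmod (l2_ip a t)" using h by (simp add: ip_self norm_power)
      also have "\<dots> \<le> l2_norm a * l2_norm t"
        using l2.cauchy_schwarz[of a t] a t by (simp add: l2_nrm)
      also have "\<dots> \<le> (C * nrm h) * l2_norm t"
        using a(2) l2.nrm_nonneg[of t] t by (intro mult_right_mono) (auto simp: l2_nrm)
      finally have "nrm h * nrm h \<le> nrm h * (C * l2_norm t)" by (simp add: power2_eq_square mult_ac)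
      then have "nrm h \<le> C * l2_norm t"
        using h C(1) l2.nrm_nonneg[of t] t nrm_nonneg[OF h]
        by (cases "nrm h = 0") (auto simp: l2_nrm dest: mult_left_le_imp_le)
      then have "(nrm h)\<^sup>2 \<le> (C * l2_norm t)\<^sup>2" using h by (intro power_mono) auto
      then have "(nrm h)\<^sup>2 \<le> C\<^sup>2 * (\<Sum>n. (cmod (t n))\<^sup>2)"
        using t by (simp add: power_mult_distrib l2_norm_sq)
      then show ?thesis using C(1) by (simp add: h_def t_def field_simps)
    qed
    obtain B where B: "0 < B" "\<forall>f\<in>H. summable (\<lambda>n. (cmod (ip f (u n)))\<^sup>2) \<and>
        (\<Sum>n. (cmod (ip f (u n)))\<^sup>2) \<le> B * (nrm f)\<^sup>2"
      using bu unfolding bessel_def by blast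
    show ?thesis
      unfolding ii_def
      by (rule exI[of _ "1 / C\<^sup>2"], rule conjI, use C(1) in simp, rule exI[of _ B])
        (use B lower in simp)
  qed
  have ii_iii: iii if *: ii
  proof -
    obtain A B where A: "0 < A" and B: "0 < B"
      and AB: "\<forall>f\<in>H. summable (\<lambda>n. (cmod (ip f (u n)))\<^sup>2) \<and>
        A * (nrm (adj L f))\<^sup>2 \<le> (\<Sum>n. (cmod (ip f (u n)))\<^sup>2) \<and>
        (\<Sum>n. (cmod (ip f (u n)))\<^sup>2) \<le> B * (nrm f)\<^sup>2"
      using * unfolding ii_def by blast
    have bu: "bessel u" unfolding bessel_def using u B AB by auto
    have "\<exists>g. bessel g \<and> (\<forall>f\<in>H. series_to (\<lambda>n. ip f (g n)) u (L f))"
      using AB by (intro factorization_if_lower_bound[OF bu L A]) auto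
    with bu show ?thesis unfolding iii_def by (rule conjI)
  qed
  have iii_i: i if *: iii
  proof -
    obtain g where g: "bessel g" "\<And>f. f \<in> H \<Longrightarrow> series_to (\<lambda>n. ip f (g n)) u (L f)"
      using * unfolding iii_def by blast
    obtain B where B: "0 < B" "\<And>f. f \<in> H \<Longrightarrow> (\<Sum>n. (cmod (ip f (g n)))\<^sup>2) \<le> B * (nrm f)\<^sup>2"
      using g(1) unfolding bessel_def by blast
    have "in_l2 (\<lambda>n. ip f (g n)) \<and> l2_norm (\<lambda>n. ip f (g n)) \<le> sqrt B * nrm f \<and>
        series_to (\<lambda>n. ip f (g n)) u (L f)" if f: "f \<in> H" for f
    proof -
      have "l2_norm (\<lambda>n. ip f (g n)) \<le> sqrt (B * (nrm f)\<^sup>2)"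
        unfolding l2_norm_def using B(2)[OF f] by (rule real_sqrt_le_mono)
      then show ?thesis
        using bessel_in_l2[OF g(1) f] g(2)[OF f] f by (simp add: real_sqrt_mult)
    qed
    then have "\<exists>C>0. \<forall>f\<in>H. \<exists>a. in_l2 a \<and> l2_norm a \<le> C * nrm f \<and> series_to a u (L f)"
      using B(1) by (intro exI[of _ "sqrt B"]) auto
    moreover have "\<forall>c. in_l2 c \<longrightarrow> (\<exists>h\<in>H. series_to c u h)"
      using * bessel_series_converges[of u] unfolding iii_def by simp
    ultimately show ?thesis unfolding i_def by simp
  qed
  have dual: "(\<forall>f\<in>H. series_to (\<lambda>n. ip f (g n)) u (L f)) \<longleftrightarrow>
      (\<forall>f\<in>H. series_to (\<lambda>n. ip f (u n)) g (adj L f))" if "bessel u" "bessel g" for g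
  proof -
    have "ip (adj L f) h = ip f (L h)" if "f \<in> H" "h \<in> H" for f h
      using ip_adj[OF L that] ip_cnj[OF LH[OF that(2)] that(1)] ip_cnj[OF that(2) adj_H[OF L that(1)]]
      by simp
    then show ?thesis
      using series_adjoint[where L = L and L' = "adj L", OF that LH adj_H[OF L] ip_adj[OF L]]
        series_adjoint[where L = "adj L" and L' = L, OF that(2,1) adj_H[OF L] LH] by auto
  qed
  have iii_iv: iv if *: iii
  proof -
    have bu: "bessel u" using * by (simp add: iii_def)
    then have "\<forall>f\<in>H. summable (\<lambda>n. (cmod (ip f (u n)))\<^sup>2)" by (auto simp: bessel_def)
    then show ?thesis using * dual[OF bu] unfolding iii_def iv_def by auto
  qed
  have iv_iii: iii if *: iv
  proof -
    have bu: "bessel u" using * by (intro bessel_if_coefficients_l2 u) (auto simp: iv_def)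
    then show ?thesis using * dual[OF bu] unfolding iii_def iv_def by auto
  qed
  from i_ii ii_iii iii_i iii_iv iv_iii show ?thesis by blast
qed

end


section \<open>Rotation invariance and radial integrals on the disk\<close>

text \<open>
  Up to a null set, Vitali's theorem fills an open set with disjoint balls, and a surjective
  isometry pulls a ball back to a ball of the same radius, hence of the same volume.
\<close>

lemma emeasure_isometry_vimage_ge:
  fixes f g :: "'a::euclidean_space \<Rightarrow> 'a"
  assumes iso: "\<And>x y. dist (f x) (f y) = dist x y" and inv: "\<And>x. f (g x) = x"
    and S: "open S"
  shows "emeasure lborel S \<le> emeasure lborel (f -` S)"
proof -
  have cont: "continuous_on UNIV f"
    by (rule continuous_on_iff[THEN iffD2]) (auto simp: iso)
  have vimage_ball: "f -` ball c r = ball (g c) r" for c r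
    using iso[of "g c"] inv by auto
  define K where "K = {i :: 'a \<times> real. 0 < snd i \<and> ball (fst i) (snd i) \<subseteq> S}"
  have cover: "\<exists>i. i \<in> K \<and> x \<in> ball (fst i) (snd i) \<and> snd i < d" if x: "x \<in> S" and d: "0 < d" for x d
  proof -
    obtain e where e: "0 < e" "ball x e \<subseteq> S" using S x openE by blast
    define r where "r = min e (d / 2)"
    have r: "0 < r" "r < d" "r \<le> e" using e d by (auto simp: r_def)
    then have "(x, r) \<in> K" using e(2) subset_ball[of r e x] by (auto simp: K_def)
    then show ?thesis using r by (intro exI[of _ "(x, r)"]) auto
  qed
  obtain C where C: "countable C" "C \<subseteq> K"
      "pairwise (\<lambda>i j. disjnt (ball (fst i) (snd i)) (ball (fst j) (snd j))) C"
      "negligible (S - (\<Union>i\<in>C. ball (fst i) (snd i)))"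
    by (rule Vitali_covering_theorem_balls[OF cover])
  define U where "U = (\<Union>i\<in>C. ball (fst i) (snd i))"
  have U: "open U" "U \<subseteq> S"
    using C(2) unfolding U_def K_def by (blast intro: open_UN[OF ballI, OF open_ball])+
  have disj: "disjoint_family_on (\<lambda>i. ball (fst i) (snd i)) C"
    using C(3) by (auto simp: disjoint_family_on_def pairwise_def disjnt_def)
  have "S - U \<in> null_sets lborel"
    using C(4) S U by (simp add: U_def[symmetric] negligible_iff_null_sets null_sets_completion_iff)
  then have "emeasure lborel (U \<union> (S - U)) = emeasure lborel U"
    using U by (intro emeasure_Un_null_set) auto
  then have "emeasure lborel S = emeasure lborel U"
    using U by (simp add: Un_absorb1)
  also have "\<dots> = (\<integral>\<^sup>+i. emeasure lborel (ball (fst i) (snd i)) \<partial>count_space C)"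
    unfolding U_def using C(1) disj by (intro emeasure_UN_countable) auto
  also have "\<dots> = (\<integral>\<^sup>+i. emeasure lborel (f -` ball (fst i) (snd i)) \<partial>count_space C)"
  proof (rule nn_integral_cong)
    fix i assume "i \<in> space (count_space C)"
    then have "0 \<le> snd i" using C(2) by (auto simp: K_def)
    then show "emeasure lborel (ball (fst i) (snd i)) = emeasure lborel (f -` ball (fst i) (snd i))"
      by (simp add: vimage_ball emeasure_ball)
  qed
  also have "\<dots> = emeasure lborel (\<Union>i\<in>C. f -` ball (fst i) (snd i))"
    using C(1) disjoint_family_on_vimageI[OF disj, of f] unfolding vimage_ball
    by (intro emeasure_UN_countable[symmetric]) auto
  also have "\<dots> \<le> emeasure lborel (f -` S)"
    using U cont S by (intro emeasure_mono) (auto simp: U_def open_vimage)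
  finally show ?thesis .
qed

lemma distr_lborel_isometry:
  fixes f g :: "'a::euclidean_space \<Rightarrow> 'a"
  assumes f: "\<And>x y. dist (f x) (f y) = dist x y" and g: "\<And>x y. dist (g x) (g y) = dist x y"
    and inv: "\<And>x. f (g x) = x" "\<And>x. g (f x) = x"
  shows "distr lborel borel f = lborel"
proof (rule lborel_eqI[symmetric])
  have cont: "continuous_on UNIV f"
    by (rule continuous_on_iff[THEN iffD2]) (auto simp: f)
  then have meas: "f \<in> borel_measurable borel" by (rule borel_measurable_continuous_onI)
  fix l u :: 'a assume le: "\<And>b. b \<in> Basis \<Longrightarrow> l \<bullet> b \<le> u \<bullet> b"
  have "emeasure (distr lborel borel f) (box l u) = emeasure lborel (f -` box l u)"
    using meas by (subst emeasure_distr) auto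
  also have "\<dots> = emeasure lborel (box l u)"
  proof (rule antisym)
    have "emeasure lborel (f -` box l u) \<le> emeasure lborel (g -` f -` box l u)"
      using g inv(2) open_vimage[OF open_box cont] by (rule emeasure_isometry_vimage_ge)
    also have "g -` f -` box l u = box l u" using inv by auto
    finally show "emeasure lborel (f -` box l u) \<le> emeasure lborel (box l u)" .
    show "emeasure lborel (box l u) \<le> emeasure lborel (f -` box l u)"
      using f inv(1) open_box by (rule emeasure_isometry_vimage_ge)
  qed
  also have "\<dots> = (\<Prod>b\<in>Basis. (u - l) \<bullet> b)" using le by simp
  finally show "emeasure (distr lborel borel f) (box l u) = (\<Prod>b\<in>Basis. (u - l) \<bullet> b)" .
qed simp

lemma unit_disk_borel [measurable]: "unit_disk \<in> sets borel"
  by simp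

text \<open>
  The density of the weighted area measure with respect to Lebesgue measure on the whole plane; it
  depends on \<open>cmod z\<close> only, which is what rotation invariance uses.
\<close>

definition weight :: "real \<Rightarrow> complex \<Rightarrow> real" where
  "weight \<eta> z = indicator unit_disk z / pi * ((\<eta> + 1) * (1 - (cmod z)\<^sup>2) powr \<eta>)"

lemma weight_measurable [measurable]: "weight \<eta> \<in> borel_measurable borel"
  unfolding weight_def by measurable

lemma weight_nonneg: "\<eta> > -1 \<Longrightarrow> 0 \<le> weight \<eta> z"
  by (simp add: weight_def)

lemma disk_area_weighted_eq_density:
  "disk_area_weighted \<eta> = density lborel (\<lambda>z. ennreal (weight \<eta> z))"
proof -
  have [measurable]: "(\<lambda>z::complex. ennreal (indicator unit_disk z / pi)) \<in> borel_measurable borel"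
    "(\<lambda>z. ennreal ((\<eta> + 1) * (1 - (cmod z)\<^sup>2) powr \<eta>)) \<in> borel_measurable borel"
    by measurable
  show ?thesis
    unfolding disk_area_weighted_def disk_area_def
    by (subst density_density_eq) (auto simp: weight_def ennreal_mult'[symmetric])
qed

lemma sets_disk_area_weighted [measurable_cong, simp]: "sets (disk_area_weighted \<eta>) = sets borel"
  by (simp add: disk_area_weighted_eq_density)

lemma space_disk_area_weighted [simp]: "space (disk_area_weighted \<eta>) = UNIV"
  by (simp add: disk_area_weighted_eq_density)

lemma AE_disk: "AE z in disk_area_weighted \<eta>. z \<in> unit_disk"
  unfolding disk_area_weighted_eq_density by (subst AE_density) (auto simp: weight_def indicator_def split: if_splits)

lemma cnj_measurable [measurable]: "cnj \<in> borel_measurable borel"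
  by (intro borel_measurable_continuous_onI continuous_intros)

lemma integral_rotate:
  fixes f :: "complex \<Rightarrow> complex"
  assumes \<eta>: "\<eta> > -1" and c: "cmod c = 1" and f [measurable]: "f \<in> borel_measurable borel"
  shows "(LINT z|disk_area_weighted \<eta>. f (c * z)) = (LINT z|disk_area_weighted \<eta>. f z)"
proof -
  have inv: "c * cnj c = 1" using c by (simp add: complex_norm_square[symmetric])
  have rot: "distr lborel borel ((*) c) = lborel"
  proof (rule distr_lborel_isometry)
    show "dist (c * x) (c * y) = dist x y" "dist (cnj c * x) (cnj c * y) = dist x y" for x y
      using c by (simp_all add: dist_norm norm_mult flip: right_diff_distrib)
    show "c * (cnj c * x) = x" "cnj c * (c * x) = x" for x
      using inv by (simp_all add: mult.assoc[symmetric] mult.commute[of "cnj c"])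
  qed
  have [measurable]: "(\<lambda>z. weight \<eta> z *\<^sub>R f z) \<in> borel_measurable borel" by measurable
  have "(LINT z|disk_area_weighted \<eta>. f z) = (LINT z|lborel. weight \<eta> z *\<^sub>R f z)"
    unfolding disk_area_weighted_eq_density by (rule integral_density) (auto simp: weight_nonneg \<eta>)
  also have "\<dots> = (LINT z|distr lborel borel ((*) c). weight \<eta> z *\<^sub>R f z)" by (simp add: rot)
  also have "\<dots> = (LINT z|lborel. weight \<eta> (c * z) *\<^sub>R f (c * z))"
    by (rule integral_distr) auto
  also have "\<dots> = (LINT z|lborel. weight \<eta> z *\<^sub>R f (c * z))"
    using c by (simp add: weight_def norm_mult indicator_def)
  also have "\<dots> = (LINT z|disk_area_weighted \<eta>. f (c * z))"
    unfolding disk_area_weighted_eq_density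
    by (rule integral_density[symmetric]) (auto simp: weight_nonneg \<eta>)
  finally show ?thesis ..
qed

text \<open>
  Under normalized area the squared modulus is uniformly distributed on the unit interval, because
  a disk of radius \<open>sqrt t\<close> has area \<open>pi * t\<close>.  This replaces polar coordinates.
\<close>

lemma distr_disk_area_sq:
  "distr disk_area borel (\<lambda>z. (cmod z)\<^sup>2) = density lborel (\<lambda>t. indicator {0..1} t)"
proof (rule measure_eqI_lessThan)
  have lhs: "emeasure (distr disk_area borel (\<lambda>z. (cmod z)\<^sup>2)) {x<..}
      = emeasure lborel ({z. x < (cmod z)\<^sup>2} \<inter> unit_disk) / ennreal pi" for x
  proof -
    have [measurable]: "{z. x < (cmod z)\<^sup>2} \<in> sets borel" by measurable
    have "emeasure (distr disk_area borel (\<lambda>z. (cmod z)\<^sup>2)) {x<..} = emeasure disk_area {z. x < (cmod z)\<^sup>2}"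
      by (subst emeasure_distr) (auto simp: disk_area_def vimage_def)
    also have "\<dots> = (\<integral>\<^sup>+z. ennreal (1 / pi) * indicator ({z. x < (cmod z)\<^sup>2} \<inter> unit_disk) z \<partial>lborel)"
      unfolding disk_area_def
      by (subst emeasure_density) (auto intro!: nn_integral_cong split: split_indicator)
    also have "\<dots> = ennreal (1 / pi) * emeasure lborel ({z. x < (cmod z)\<^sup>2} \<inter> unit_disk)"
      by (rule nn_integral_cmult_indicator) measurable
    finally show ?thesis
      by (simp add: divide_ennreal_def inverse_ennreal inverse_eq_divide mult.commute)
  qed
  have rhs: "emeasure (density lborel (\<lambda>t. indicator {0..1} t)) {x<..}
      = emeasure lborel ({0..1} \<inter> {x<..})" for x :: real
    by (subst emeasure_density) (auto simp: indicator_inter_arith[symmetric] nn_integral_indicator)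
  show eq: "emeasure (distr disk_area borel (\<lambda>z. (cmod z)\<^sup>2)) {x<..}
      = emeasure (density lborel (\<lambda>t. indicator {0..1} t)) {x<..}" for x
  proof -
    consider "x < 0" | "0 \<le> x" "x < 1" | "1 \<le> x" by linarith
    then show ?thesis
    proof cases
      case 1
      have "x < (cmod z)\<^sup>2" for z using 1 zero_le_power2[of "cmod z"] by linarith
      then have "{z. x < (cmod z)\<^sup>2} \<inter> unit_disk = unit_disk" by auto
      moreover have "{0..1} \<inter> {x<..} = {0..1}" using 1 by auto
      ultimately show ?thesis
        unfolding lhs rhs by (simp add: emeasure_ball unit_ball_vol_2 divide_ennreal)
    next
      case 2
      have sq: "x < (cmod z)\<^sup>2 \<longleftrightarrow> sqrt x < cmod z" for z
        using real_sqrt_less_iff[of x "(cmod z)\<^sup>2"] by simp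
      have "{z. x < (cmod z)\<^sup>2} \<inter> unit_disk = unit_disk - cball 0 (sqrt x)"
        unfolding sq by auto
      moreover have "emeasure lborel (unit_disk - cball 0 (sqrt x))
          = emeasure lborel unit_disk - emeasure lborel (cball 0 (sqrt x) :: complex set)"
        using 2 by (intro emeasure_Diff) (simp_all add: emeasure_cball cball_subset_ball_iff)
      moreover have "{0..1} \<inter> {x<..} = {x<..1}" using 2 by auto
      ultimately show ?thesis
        unfolding lhs rhs using 2
        by (simp add: emeasure_ball emeasure_cball unit_ball_vol_2 divide_ennreal ennreal_minus
            right_diff_distrib' diff_divide_distrib)
    next
      case 3
      have "\<not> x < (cmod z)\<^sup>2" if "cmod z < 1" for z
        using 3 that power_le_one[of "cmod z" 2] by simp
      then have "{z. x < (cmod z)\<^sup>2} \<inter> unit_disk = {}" by auto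
      moreover have "{0..1} \<inter> {x<..} = {}" using 3 by auto
      ultimately show ?thesis unfolding lhs rhs by simp
    qed
  qed
  show "emeasure (distr disk_area borel (\<lambda>z. (cmod z)\<^sup>2)) {x<..} < \<infinity>" for x
  proof -
    have "emeasure lborel ({0..1} \<inter> {x<..}) \<le> emeasure lborel {0..1::real}"
      by (intro emeasure_mono) auto
    also have "\<dots> < \<infinity>" by simp
    finally show ?thesis unfolding eq rhs .
  qed
qed (simp_all add: disk_area_def)

text \<open>
  The squared norm of \<open>z \<mapsto> z ^ n\<close> in the weighted Bergman space, for \<open>\<eta> > -1\<close>.
\<close>

definition monomial_norm_sq :: "real \<Rightarrow> nat \<Rightarrow> real" where
  "monomial_norm_sq \<eta> n = fact n / pochhammer (\<eta> + 2) n"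

lemma monomial_norm_sq_pos: "\<eta> > -1 \<Longrightarrow> 0 < monomial_norm_sq \<eta> n"
  by (simp add: monomial_norm_sq_def pochhammer_pos)

lemma Beta_eq_monomial_norm_sq:
  assumes "\<eta> > -1"
  shows "(\<eta> + 1) * Beta (real n + 1) (\<eta> + 1) = monomial_norm_sq \<eta> n"
proof -
  have "pochhammer (\<eta> + 2) n = Gamma (\<eta> + 2 + real n) / Gamma (\<eta> + 2)"
    using assms by (intro pochhammer_Gamma) (auto elim!: nonpos_Ints_cases)
  moreover have "Gamma (\<eta> + 2) = (\<eta> + 1) * Gamma (\<eta> + 1)"
  proof -
    have "\<eta> + 1 \<notin> \<int>\<^sub>\<le>\<^sub>0" using assms by (auto elim!: nonpos_Ints_cases)
    then show ?thesis using Gamma_plus1[of "\<eta> + 1"] by (simp add: add.assoc)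
  qed
  moreover have "Gamma (real n + 1) = fact n" by (simp add: Gamma_fact add.commute)
  moreover have "Gamma (\<eta> + 1) > 0" "Gamma (\<eta> + 2 + real n) > 0"
    using assms by (auto intro: Gamma_real_pos)
  ultimately show ?thesis
    using assms by (simp add: Beta_def monomial_norm_sq_def field_simps)
qed

lemma nn_integral_monomial:
  assumes \<eta>: "\<eta> > -1"
  shows "(\<integral>\<^sup>+z. ennreal ((cmod z) ^ (2 * n)) \<partial>disk_area_weighted \<eta>) = ennreal (monomial_norm_sq \<eta> n)"
proof -
  define h where "h t = (\<eta> + 1) * (1 - t) powr \<eta> * t ^ n" for t :: real
  have [measurable]: "h \<in> borel_measurable borel" unfolding h_def by measurable
  have "(\<integral>\<^sup>+z. ennreal ((cmod z) ^ (2 * n)) \<partial>disk_area_weighted \<eta>)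
      = (\<integral>\<^sup>+z. ennreal (h ((cmod z)\<^sup>2)) \<partial>disk_area)"
    unfolding disk_area_weighted_def using \<eta>
    by (subst nn_integral_density)
      (auto simp: disk_area_def h_def ennreal_mult'[symmetric] power_mult mult.assoc
        intro!: nn_integral_cong)
  also have "\<dots> = (\<integral>\<^sup>+t. ennreal (h t) \<partial>distr disk_area borel (\<lambda>z. (cmod z)\<^sup>2))"
    by (rule nn_integral_distr[symmetric]) (auto simp: disk_area_def)
  also have "\<dots> = (\<integral>\<^sup>+t. indicator {0..1} t * ennreal (h t) \<partial>lborel)"
    unfolding distr_disk_area_sq by (rule nn_integral_density) auto
  also have "\<dots> = (\<integral>\<^sup>+t. ennreal (h t) * indicator {0..1} t \<partial>lborel)"
    by (simp add: mult.commute)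
  also have "\<dots> = ennreal ((\<eta> + 1) * Beta (real n + 1) (\<eta> + 1))"
  proof (rule nn_integral_has_integral_lebesgue')
    have "((\<lambda>t. (\<eta> + 1) * (t powr (real n + 1 - 1) * (1 - t) powr (\<eta> + 1 - 1)))
        has_integral (\<eta> + 1) * Beta (real n + 1) (\<eta> + 1)) {0..1}"
      using has_integral_Beta_real[of "real n + 1" "\<eta> + 1"] \<eta>
      by (intro has_integral_mult_right) auto
    then have "((\<lambda>t. (\<eta> + 1) * (t powr (real n + 1 - 1) * (1 - t) powr (\<eta> + 1 - 1)))
        has_integral (\<eta> + 1) * Beta (real n + 1) (\<eta> + 1)) {0<..<1}"
      by (simp add: has_integral_Icc_iff_Ioo)
    then have "(h has_integral (\<eta> + 1) * Beta (real n + 1) (\<eta> + 1)) {0<..<1}"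
      by (rule has_integral_eq[rotated]) (auto simp: h_def powr_realpow)
    then show "(h has_integral (\<eta> + 1) * Beta (real n + 1) (\<eta> + 1)) {0..1}"
      by (simp add: has_integral_Icc_iff_Ioo)
  qed (use \<eta> in \<open>auto simp: h_def\<close>)
  finally show ?thesis by (simp only: Beta_eq_monomial_norm_sq[OF \<eta>])
qed

lemma disk_area_weighted_UNIV:
  assumes "\<eta> > -1"
  shows "emeasure (disk_area_weighted \<eta>) UNIV = 1"
  using nn_integral_monomial[OF assms, of 0] by (simp add: monomial_norm_sq_def)


section \<open>The Bergman space as an inner product space\<close>

lemma bergman_space_iff:
  "f \<in> bergman_space \<eta> \<longleftrightarrow> f holomorphic_on unit_disk \<and> (\<forall>z. z \<notin> unit_disk \<longrightarrow> f z = 0) \<and>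
     integrable (disk_area_weighted \<eta>) (\<lambda>z. (cmod (f z))\<^sup>2)"
  by (simp add: bergman_space_def)

lemma measurable_if_holomorphic_on_disk:
  assumes "f holomorphic_on unit_disk" "\<And>z. z \<notin> unit_disk \<Longrightarrow> f z = 0"
  shows "f \<in> borel_measurable borel"
proof -
  have "(\<lambda>z. indicator unit_disk z *\<^sub>R f z) \<in> borel_measurable borel"
    using assms(1) by (intro borel_measurable_continuous_on_indicator) (auto simp: holomorphic_on_imp_continuous_on)
  moreover have "(\<lambda>z. indicator unit_disk z *\<^sub>R f z) = f"
    using assms(2) by (auto simp: fun_eq_iff indicator_def)
  ultimately show ?thesis by simp
qed

lemma bergman_measurable: "f \<in> bergman_space \<eta> \<Longrightarrow> f \<in> borel_measurable borel"
  by (rule measurable_if_holomorphic_on_disk) (auto simp: bergman_space_iff)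

lemma integrable_bergman_mult:
  assumes "f \<in> bergman_space \<eta>" "g \<in> bergman_space \<eta>"
  shows "integrable (disk_area_weighted \<eta>) (\<lambda>z. f z * cnj (g z))"
proof (rule Bochner_Integration.integrable_bound)
  have [measurable]: "f \<in> borel_measurable borel" "g \<in> borel_measurable borel"
    using assms by (auto intro: bergman_measurable)
  show "integrable (disk_area_weighted \<eta>) (\<lambda>z. (cmod (f z))\<^sup>2 + (cmod (g z))\<^sup>2)"
    using assms by (auto simp: bergman_space_iff)
  show "(\<lambda>z. f z * cnj (g z)) \<in> borel_measurable (disk_area_weighted \<eta>)" by measurable
  have "cmod (f z * cnj (g z)) \<le> (cmod (f z))\<^sup>2 + (cmod (g z))\<^sup>2" for z
    using sum_squares_bound[of "cmod (f z)" "cmod (g z)"]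
      mult_nonneg_nonneg[OF norm_ge_zero norm_ge_zero, of "f z" "g z"]
    unfolding norm_mult complex_mod_cnj by linarith
  then show "AE z in disk_area_weighted \<eta>. norm (f z * cnj (g z)) \<le> norm ((cmod (f z))\<^sup>2 + (cmod (g z))\<^sup>2)"
    by (intro AE_I2) (auto intro: order_trans[OF _ abs_ge_self])
qed

lemma bergman_inner_self: "bergman_inner \<eta> f f = of_real (LINT z|disk_area_weighted \<eta>. (cmod (f z))\<^sup>2)"
  unfolding bergman_inner_def complex_norm_square[symmetric] by (rule integral_complex_of_real)

lemma bergman_space_add:
  assumes f: "f \<in> bergman_space \<eta>" and g: "g \<in> bergman_space \<eta>"
  shows "(\<lambda>z. f z + g z) \<in> bergman_space \<eta>"
proof -
  have [measurable]: "f \<in> borel_measurable borel" "g \<in> borel_measurable borel"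
    using assms by (auto intro: bergman_measurable)
  have "integrable (disk_area_weighted \<eta>) (\<lambda>z. (cmod (f z + g z))\<^sup>2)"
  proof (rule Bochner_Integration.integrable_bound)
    show "integrable (disk_area_weighted \<eta>) (\<lambda>z. 2 * (cmod (f z))\<^sup>2 + 2 * (cmod (g z))\<^sup>2)"
      using assms by (auto simp: bergman_space_iff)
    have "(cmod (f z + g z))\<^sup>2 \<le> 2 * (cmod (f z))\<^sup>2 + 2 * (cmod (g z))\<^sup>2" for z
    proof -
      have "(cmod (f z + g z))\<^sup>2 \<le> (cmod (f z) + cmod (g z))\<^sup>2"
        by (intro power_mono norm_triangle_ineq) simp
      moreover have "0 \<le> (cmod (f z) - cmod (g z))\<^sup>2" by simp
      ultimately show ?thesis by (simp add: power2_sum power2_diff)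
    qed
    then show "AE z in disk_area_weighted \<eta>.
        norm ((cmod (f z + g z))\<^sup>2) \<le> norm (2 * (cmod (f z))\<^sup>2 + 2 * (cmod (g z))\<^sup>2)"
      by (intro AE_I2) simp
  qed measurable
  with assms show ?thesis by (auto simp: bergman_space_iff intro: holomorphic_on_add)
qed

lemma bergman_space_scale: "f \<in> bergman_space \<eta> \<Longrightarrow> (\<lambda>z. c * f z) \<in> bergman_space \<eta>"
  by (auto simp: bergman_space_iff norm_mult power_mult_distrib intro: holomorphic_on_mult)

lemma bergman_space_diff:
  assumes "f \<in> bergman_space \<eta>" "g \<in> bergman_space \<eta>"
  shows "(\<lambda>z. f z - g z) \<in> bergman_space \<eta>"
  using bergman_space_add[OF assms(1) bergman_space_scale[OF assms(2), of "-1"]] by simp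

lemma semi_inner_space_bergman:
  "semi_inner_space (\<lambda>c f z. c * f z) (bergman_space \<eta>) (bergman_inner \<eta>)"
proof (intro semi_inner_space.intro vector_space_fun semi_inner_space_axioms.intro)
  interpret vector_space "\<lambda>c f z. c * f z :: complex" by (rule vector_space_fun)
  show "subspace (bergman_space \<eta>)"
    by (rule subspaceI)
      (auto simp: bergman_space_scale plus_fun_def bergman_space_add, simp add: bergman_space_iff zero_fun_def)
next
  fix f g h :: "complex \<Rightarrow> complex" and c
  assume f: "f \<in> bergman_space \<eta>" and g: "g \<in> bergman_space \<eta>"
  show "bergman_inner \<eta> (f + g) h = bergman_inner \<eta> f h + bergman_inner \<eta> g h"
    if h: "h \<in> bergman_space \<eta>"
    using integrable_bergman_mult[OF f h] integrable_bergman_mult[OF g h]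
    by (simp add: bergman_inner_def distrib_right)
  show "bergman_inner \<eta> (\<lambda>z. c * f z) g = c * bergman_inner \<eta> f g"
    by (simp add: bergman_inner_def mult.assoc)
  have "bergman_inner \<eta> g f = (LINT z|disk_area_weighted \<eta>. cnj (f z * cnj (g z)))"
    by (simp add: bergman_inner_def mult.commute)
  also have "\<dots> = cnj (bergman_inner \<eta> f g)"
    unfolding bergman_inner_def by (rule Bochner_Integration.integral_cnj)
  finally show "bergman_inner \<eta> g f = cnj (bergman_inner \<eta> f g)" .
  show "0 \<le> Re (bergman_inner \<eta> f f)"
    by (simp add: bergman_inner_self)
qed

lemma bergman_norm_eq: "bergman_norm \<eta> f = sqrt (Re (bergman_inner \<eta> f f))"
  by (simp add: bergman_norm_def bergman_inner_self)

lemma bergman_cauchy_schwarz: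
  assumes "f \<in> bergman_space \<eta>" "g \<in> bergman_space \<eta>"
  shows "cmod (bergman_inner \<eta> f g) \<le> bergman_norm \<eta> f * bergman_norm \<eta> g"
proof -
  interpret semi_inner_space "\<lambda>c f z. c * f z" "bergman_space \<eta>" "bergman_inner \<eta>"
    by (rule semi_inner_space_bergman)
  show ?thesis
    using cauchy_schwarz[OF assms] unfolding nrm_def bergman_norm_eq .
qed

section \<open>Taylor coefficients as inner products\<close>

context
  fixes \<eta> :: real
  assumes \<eta>: "\<eta> > -1"
begin

lemma finite_measure_disk_area_weighted: "finite_measure (disk_area_weighted \<eta>)"
  by (rule finite_measureI) (simp add: disk_area_weighted_UNIV \<eta>)

lemma integrable_if_bounded:
  fixes f :: "complex \<Rightarrow> 'b::{banach, second_countable_topology}"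
  assumes "f \<in> borel_measurable borel" "\<And>z. z \<in> unit_disk \<Longrightarrow> norm (f z) \<le> B"
  shows "integrable (disk_area_weighted \<eta>) f"
proof -
  interpret finite_measure "disk_area_weighted \<eta>" by (rule finite_measure_disk_area_weighted)
  show ?thesis
    using assms AE_disk[of \<eta>] by (intro integrable_const_bound[of _ B]) (auto elim: eventually_mono)
qed

lemma integral_norm_le:
  fixes f :: "complex \<Rightarrow> 'b::{banach, second_countable_topology}"
  assumes "f \<in> borel_measurable borel" "\<And>z. norm (f z) \<le> B"
  shows "(LINT z|disk_area_weighted \<eta>. norm (f z)) \<le> B"
proof -
  interpret finite_measure "disk_area_weighted \<eta>" by (rule finite_measure_disk_area_weighted)
  have "(LINT z|disk_area_weighted \<eta>. norm (f z)) \<le> (LINT z|disk_area_weighted \<eta>. B)"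
    using assms by (intro integral_mono integrable_norm integrable_if_bounded[of _ B] integrable_const) auto
  then show ?thesis by (simp add: measure_def disk_area_weighted_UNIV \<eta>)
qed

lemma integrable_bergman:
  assumes f: "f \<in> bergman_space \<eta>"
  shows "integrable (disk_area_weighted \<eta>) f"
proof (rule Bochner_Integration.integrable_bound)
  interpret finite_measure "disk_area_weighted \<eta>" by (rule finite_measure_disk_area_weighted)
  have [measurable]: "f \<in> borel_measurable borel" using f by (rule bergman_measurable)
  show "integrable (disk_area_weighted \<eta>) (\<lambda>z. 1 + (cmod (f z))\<^sup>2)"
    using f by (auto simp: bergman_space_iff)
  have "cmod (f z) \<le> 1 + (cmod (f z))\<^sup>2" for z
    using sum_squares_bound[of 1 "cmod (f z)"] norm_ge_zero[of "f z"]
    unfolding mult_1_right power_one by linarith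
  then show "AE z in disk_area_weighted \<eta>. norm (f z) \<le> norm (1 + (cmod (f z))\<^sup>2)"
    by (intro AE_I2) (auto intro: order_trans[OF _ abs_ge_self])
  show "f \<in> borel_measurable (disk_area_weighted \<eta>)" by measurable
qed

text \<open>
  Rotation by the angle \<open>pi / (m - n)\<close> multiplies the integrand by \<open>cis pi = - 1\<close> but does not change
  the integral.
\<close>

lemma integral_monomial_products_eq_0:
  assumes mn: "m \<noteq> n"
  shows "(LINT z|disk_area_weighted \<eta>. indicator (ball 0 r) z *\<^sub>R (z ^ m * cnj z ^ n)) = 0"
proof -
  define h where "h z = indicator (ball 0 r) z *\<^sub>R (z ^ m * cnj z ^ n)" for z :: complex
  have [measurable]: "h \<in> borel_measurable borel"
  proof -
    have [measurable]: "ball 0 r \<in> sets (borel :: complex measure)" by simp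
    have "(\<lambda>z::complex. z ^ m * cnj z ^ n) \<in> borel_measurable borel"
      by (intro borel_measurable_continuous_onI continuous_intros)
    then show ?thesis unfolding h_def by (intro borel_measurable_scaleR borel_measurable_indicator) auto
  qed
  define k where "k = real m - real n"
  define c where "c = cis (pi / k)"
  have "k \<noteq> 0" using mn by (simp add: k_def)
  have c: "cmod c = 1" by (simp add: c_def)
  have "c ^ m * cnj c ^ n = cis (real m * (pi / k) - real n * (pi / k))"
    by (simp add: c_def Complex.DeMoivre cis_cnj cis_mult)
  also have "real m * (pi / k) - real n * (pi / k) = pi"
    using \<open>k \<noteq> 0\<close> unfolding left_diff_distrib[symmetric] k_def[symmetric] by simp
  finally have cc: "c ^ m * cnj c ^ n = - 1" by simp
  have "h (c * z) = - h z" for z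
  proof -
    have "(c * z) ^ m * cnj (c * z) ^ n = (c ^ m * cnj c ^ n) * (z ^ m * cnj z ^ n)"
      by (simp add: power_mult_distrib mult_ac)
    then show ?thesis using c unfolding h_def cc by (simp add: norm_mult indicator_def)
  qed
  then have "(LINT z|disk_area_weighted \<eta>. h z) = - (LINT z|disk_area_weighted \<eta>. h z)"
    using integral_rotate[OF \<eta> c, of h] by simp
  then show ?thesis unfolding h_def by simp
qed

lemma integral_monomial_sq: "(LINT z|disk_area_weighted \<eta>. (cmod z) ^ (2 * n)) = monomial_norm_sq \<eta> n"
  using nn_integral_monomial[OF \<eta>, of n] monomial_norm_sq_pos[OF \<eta>, of n]
  by (subst integral_eq_nn_integral) auto

text \<open>
  On a smaller disk of radius \<open>r\<close> the Taylor series converges normally, so it may be integrated term by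
  term and orthogonality leaves a single term.  The integrands are dominated by \<open>cmod (f z)\<close>, which
  is integrable, so \<open>r\<close> may tend to \<open>1\<close>.
\<close>

lemma integral_bergman_monomial:
  assumes f: "f \<in> bergman_space \<eta>"
  shows "(LINT z|disk_area_weighted \<eta>. f z * cnj z ^ n) = (deriv ^^ n) f 0 / fact n * monomial_norm_sq \<eta> n"
proof -
  define a where "a m = (deriv ^^ m) f 0 / fact m" for m
  have [measurable]: "f \<in> borel_measurable borel" using f by (rule bergman_measurable)
  have hol: "f holomorphic_on unit_disk" using f by (simp add: bergman_space_iff)
  have [measurable]: "(\<lambda>z. cnj z ^ n) \<in> borel_measurable borel"
    by (intro borel_measurable_continuous_onI continuous_intros)
  have [measurable]: "ball 0 r \<in> sets (borel :: complex measure)" for r by simp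
  have series: "(\<lambda>m. a m * z ^ m) sums f z" if "z \<in> unit_disk" for z
    using holomorphic_power_series[OF hol that] by (simp add: a_def)
  have inner: "(LINT z|disk_area_weighted \<eta>. indicator (ball 0 r) z *\<^sub>R (f z * cnj z ^ n))
      = a n * (LINT z|disk_area_weighted \<eta>. indicator (ball 0 r) z * (cmod z) ^ (2 * n))"
    if r: "0 < r" "r < 1" for r
  proof -
    define F where "F m z = indicator (ball 0 r) z *\<^sub>R (a m * z ^ m * cnj z ^ n)" for m and z :: complex
    obtain s where s: "r < s" "s < 1" using dense[OF r(2)] by blast
    have "summable (\<lambda>m. norm (a m * of_real r ^ m))"
    proof (rule powser_insidea)
      show "summable (\<lambda>m. a m * of_real s ^ m)"
        using series[of "of_real s"] s r by (auto simp: sums_iff)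
      show "norm (of_real r :: complex) < norm (of_real s :: complex)" using r s by simp
    qed
    then have summ: "summable (\<lambda>m. cmod (a m) * r ^ m)"
      using r by (simp add: norm_mult norm_power)
    have F_meas [measurable]: "F m \<in> borel_measurable borel" for m
      unfolding F_def
      by (intro borel_measurable_scaleR borel_measurable_indicator borel_measurable_continuous_onI
          continuous_intros) auto
    have F_le: "norm (F m z) \<le> cmod (a m) * r ^ m" for m z
    proof (cases "z \<in> ball 0 r")
      case True
      then have "cmod z ^ m \<le> r ^ m" "cmod z ^ n \<le> 1"
        using r by (auto intro!: power_mono power_le_one)
      then have "cmod z ^ m * cmod z ^ n \<le> r ^ m * 1" using r by (intro mult_mono) auto
      then show ?thesis
        using True by (simp add: F_def norm_mult norm_power mult.assoc mult_left_mono)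
    next
      case False
      then show ?thesis using r by (simp add: F_def)
    qed
    have "(\<lambda>m. LINT z|disk_area_weighted \<eta>. F m z) sums (LINT z|disk_area_weighted \<eta>. (\<Sum>m. F m z))"
    proof (rule sums_integral)
      show "integrable (disk_area_weighted \<eta>) (F m)" for m using F_le by (intro integrable_if_bounded) auto
      show "AE z in disk_area_weighted \<eta>. summable (\<lambda>m. norm (F m z))"
        by (intro AE_I2 summable_comparison_test'[OF summ, of 0]) (use F_le in simp)
      have "norm (LINT z|disk_area_weighted \<eta>. norm (F m z)) \<le> cmod (a m) * r ^ m" for m
        using integral_norm_le[OF F_meas F_le] by simp
      then show "summable (\<lambda>m. LINT z|disk_area_weighted \<eta>. norm (F m z))"
        by (intro summable_comparison_test'[OF summ, of 0]) simp
    qed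
    moreover have "(\<Sum>m. F m z) = indicator (ball 0 r) z *\<^sub>R (f z * cnj z ^ n)" for z
    proof (cases "z \<in> ball 0 r")
      case True
      then have "z \<in> unit_disk" using r by simp
      from sums_mult2[OF series[OF this], of "cnj z ^ n"] True show ?thesis
        by (simp add: F_def sums_iff)
    qed (simp add: F_def)
    moreover have "(LINT z|disk_area_weighted \<eta>. F m z) = (if m = n then a n * (LINT z|disk_area_weighted \<eta>. indicator (ball 0 r) z * (cmod z) ^ (2 * n)) else 0)" for m
    proof -
      have F_eq: "F m = (\<lambda>z. a m * (indicator (ball 0 r) z *\<^sub>R (z ^ m * cnj z ^ n)))"
        by (auto simp: F_def fun_eq_iff mult_ac)
      have eq: "(LINT z|disk_area_weighted \<eta>. F m z) = a m * (LINT z|disk_area_weighted \<eta>. indicator (ball 0 r) z *\<^sub>R (z ^ m * cnj z ^ n))"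
        unfolding F_eq by (rule integral_mult_right_zero)
      show ?thesis
      proof (cases "m = n")
        case True
        have "indicator (ball 0 r) z *\<^sub>R (z ^ n * cnj z ^ n)
            = complex_of_real (indicator (ball 0 r) z * (cmod z) ^ (2 * n))" for z
          by (simp add: power_mult_distrib[symmetric] complex_norm_square[symmetric] power_mult
              scaleR_conv_of_real)
        then show ?thesis using True eq by (simp only: integral_complex_of_real if_True simp_thms)
      next
        case False
        then show ?thesis using eq integral_monomial_products_eq_0[OF False] by simp
      qed
    qed
    ultimately have "(\<lambda>m. if m = n then a n * (LINT z|disk_area_weighted \<eta>. indicator (ball 0 r) z * (cmod z) ^ (2 * n)) else 0)
        sums (LINT z|disk_area_weighted \<eta>. indicator (ball 0 r) z *\<^sub>R (f z * cnj z ^ n))" by simp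
    from sums_unique2[OF sums_single this] show ?thesis by simp
  qed
  define r where "r k = 1 - 1 / (real k + 2)" for k
  have r: "0 < r k" "r k < 1" for k by (auto simp: r_def field_simps)
  have r_lim: "(\<lambda>k. indicator (ball 0 (r k)) z) \<longlonglongrightarrow> (1::real)" if "z \<in> unit_disk" for z :: complex
  proof -
    have "r \<longlonglongrightarrow> 1" unfolding r_def by real_asymp
    then have "\<forall>\<^sub>F k in sequentially. cmod z < r k"
      using that by (intro order_tendstoD) auto
    then have "\<forall>\<^sub>F k in sequentially. indicator (ball 0 (r k)) z = (1::real)"
      by eventually_elim simp
    then show ?thesis by (rule tendsto_eventually)
  qed
  have "(\<lambda>k. LINT z|disk_area_weighted \<eta>. indicator (ball 0 (r k)) z *\<^sub>R (f z * cnj z ^ n)) \<longlonglongrightarrow> (LINT z|disk_area_weighted \<eta>. f z * cnj z ^ n)"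
  proof (rule integral_dominated_convergence[where w = "\<lambda>z. cmod (f z)"])
    show "integrable (disk_area_weighted \<eta>) (\<lambda>z. cmod (f z))" using integrable_bergman[OF f] by (rule integrable_norm)
    show "AE z in disk_area_weighted \<eta>. (\<lambda>k. indicator (ball 0 (r k)) z *\<^sub>R (f z * cnj z ^ n)) \<longlonglongrightarrow> f z * cnj z ^ n"
      using AE_disk[of \<eta>]
    proof eventually_elim
      case (elim z)
      show ?case using tendsto_scaleR[OF r_lim[OF elim] tendsto_const[of "f z * cnj z ^ n"]] by simp
    qed
    show "AE z in disk_area_weighted \<eta>. norm (indicator (ball 0 (r k)) z *\<^sub>R (f z * cnj z ^ n)) \<le> cmod (f z)" for k
      using AE_disk[of \<eta>]
    proof eventually_elim
      case (elim z)
      then have "cmod z ^ n \<le> 1" by (intro power_le_one) auto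
      then show ?case by (simp add: norm_mult norm_power indicator_def mult_left_le)
    qed
  qed measurable
  moreover have "(\<lambda>k. a n * (LINT z|disk_area_weighted \<eta>. indicator (ball 0 (r k)) z * (cmod z) ^ (2 * n)))
      \<longlonglongrightarrow> a n * (LINT z|disk_area_weighted \<eta>. (cmod z) ^ (2 * n))"
  proof (intro tendsto_mult tendsto_const tendsto_of_real
      integral_dominated_convergence[where w = "\<lambda>z. 1"])
    interpret finite_measure "disk_area_weighted \<eta>" by (rule finite_measure_disk_area_weighted)
    show "integrable (disk_area_weighted \<eta>) (\<lambda>z. 1 :: real)" by simp
    show "AE z in disk_area_weighted \<eta>. (\<lambda>k. indicator (ball 0 (r k)) z * (cmod z) ^ (2 * n)) \<longlonglongrightarrow> (cmod z) ^ (2 * n)"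
      using AE_disk[of \<eta>]
    proof eventually_elim
      case (elim z)
      show ?case using tendsto_mult[OF r_lim[OF elim] tendsto_const[of "(cmod z) ^ (2 * n)"]] by simp
    qed
    show "AE z in disk_area_weighted \<eta>. norm (indicator (ball 0 (r k)) z * (cmod z) ^ (2 * n)) \<le> 1" for k
      using AE_disk[of \<eta>]
    proof eventually_elim
      case (elim z)
      then have "cmod z ^ (2 * n) \<le> 1" by (intro power_le_one) auto
      then show ?case by (simp add: indicator_def)
    qed
  qed measurable
  ultimately have "(LINT z|disk_area_weighted \<eta>. f z * cnj z ^ n) = a n * (LINT z|disk_area_weighted \<eta>. (cmod z) ^ (2 * n))"
    unfolding inner[OF r] by (rule LIMSEQ_unique)
  then show ?thesis by (simp add: integral_monomial_sq a_def)
qed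

end


section \<open>The reproducing kernel and completeness\<close>

definition kernel_factor :: "real \<Rightarrow> complex \<Rightarrow> real" where
  "kernel_factor \<eta> w = (1 - (cmod w)\<^sup>2) powr (1 + \<eta> / 2)"

text \<open>
  With \<open>r = cmod w\<close> this dominates the kernel series at \<open>w\<close> term by term, uniformly on the disk; its
  sum is \<open>(1 - r) powr - (2 + \<eta>)\<close> for \<open>0 \<le> r < 1\<close>.
\<close>

definition kernel_majorant :: "real \<Rightarrow> real \<Rightarrow> real" where
  "kernel_majorant \<eta> r = (\<Sum>n. r ^ n / monomial_norm_sq \<eta> n)"

context
  fixes \<eta> :: real
  assumes \<eta>: "\<eta> > -1"
begin


lemma kernel_factor_pos: "w \<in> unit_disk \<Longrightarrow> 0 < kernel_factor \<eta> w"
  using abs_square_less_1[of "cmod w"] by (simp add: kernel_factor_def)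


lemma summable_kernel_majorant:
  assumes "0 \<le> r" "r < 1"
  shows "summable (\<lambda>n. r ^ n / monomial_norm_sq \<eta> n)"
proof -
  have "(\<lambda>n. ((- (2 + \<eta>)) gchoose n) * (- r) ^ n) sums (1 + (- r)) powr (- (2 + \<eta>))"
    using assms by (intro gen_binomial_real) simp
  moreover have "((- (2 + \<eta>)) gchoose n) * (- r) ^ n = r ^ n / monomial_norm_sq \<eta> n" for n
  proof -
    have "(- 1) ^ n * (- r) ^ n = r ^ n" by (simp flip: power_mult_distrib)
    then show ?thesis
      by (simp add: gbinomial_pochhammer monomial_norm_sq_def add.commute)
  qed
  ultimately show ?thesis by (simp add: sums_iff)
qed

lemma kernel_majorant_nonneg:
  assumes "0 \<le> r" "r < 1"
  shows "0 \<le> kernel_majorant \<eta> r"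
  unfolding kernel_majorant_def
  using assms monomial_norm_sq_pos[OF \<eta>, THEN less_imp_le]
  by (intro suminf_nonneg summable_kernel_majorant) auto

lemma kernel_majorant_mono:
  assumes "0 \<le> r" "r \<le> s" "s < 1"
  shows "kernel_majorant \<eta> r \<le> kernel_majorant \<eta> s"
  unfolding kernel_majorant_def
  using assms monomial_norm_sq_pos[OF \<eta>, THEN less_imp_le]
  by (intro suminf_le summable_kernel_majorant divide_right_mono power_mono) auto

text \<open>
  The binomial series at \<open>- (cnj w * z)\<close> with exponent \<open>- (2 + \<eta>)\<close>, whose coefficients are, up to
  sign, \<open>pochhammer (\<eta> + 2) n / fact n\<close>.
\<close>

lemma normalized_kernel_sums:
  assumes w: "w \<in> unit_disk" and z: "z \<in> unit_disk"
  shows "(\<lambda>n. of_real (kernel_factor \<eta> w / monomial_norm_sq \<eta> n) * cnj w ^ n * z ^ n)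
    sums normalized_kernel \<eta> w z"
proof -
  define a :: complex where "a = - of_real (2 + \<eta>)"
  have "cmod w * cmod z < 1"
    using w z mult_strict_mono'[of "cmod w" 1 "cmod z" 1] by simp
  then have "(\<lambda>n. (a gchoose n) * (- (cnj w * z)) ^ n) sums (1 + (- (cnj w * z))) powr a"
    by (intro gen_binomial_complex) (simp add: norm_mult)
  moreover have "(a gchoose n) * (- (cnj w * z)) ^ n
      = of_real (1 / monomial_norm_sq \<eta> n) * cnj w ^ n * z ^ n" for n
  proof -
    have "pochhammer (- a) n = of_real (pochhammer (\<eta> + 2) n)"
      by (simp add: a_def pochhammer_of_real add.commute del: of_real_add)
    moreover have "(- 1) ^ n * (- (cnj w * z)) ^ n = cnj w ^ n * z ^ n"
      by (simp flip: power_mult_distrib)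
    ultimately show ?thesis
      by (simp add: gbinomial_pochhammer monomial_norm_sq_def mult.left_commute)
  qed
  moreover have "(1 + (- (cnj w * z))) powr a = 1 / (1 - cnj w * z) powr of_real (2 + \<eta>)"
    by (simp add: a_def powr_minus inverse_eq_divide del: of_real_add)
  ultimately have "(\<lambda>n. of_real (1 / monomial_norm_sq \<eta> n) * cnj w ^ n * z ^ n)
      sums (1 / (1 - cnj w * z) powr of_real (2 + \<eta>))" by simp
  from sums_mult[OF this, of "of_real (kernel_factor \<eta> w)"] z show ?thesis
    by (simp add: normalized_kernel_def kernel_factor_def mult.assoc)
qed

lemma normalized_kernel_bound:
  assumes w: "w \<in> unit_disk"
  shows "cmod (normalized_kernel \<eta> w z) \<le> kernel_factor \<eta> w * kernel_majorant \<eta> (cmod w)"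
proof (cases "z \<in> unit_disk")
  case True
  let ?t = "\<lambda>n. of_real (kernel_factor \<eta> w / monomial_norm_sq \<eta> n) * cnj w ^ n * z ^ n"
  have summ: "summable (\<lambda>n. kernel_factor \<eta> w * (cmod w ^ n / monomial_norm_sq \<eta> n))"
    using w by (intro summable_mult summable_kernel_majorant) auto
  have le: "cmod (?t n) \<le> kernel_factor \<eta> w * (cmod w ^ n / monomial_norm_sq \<eta> n)" for n
  proof -
    have "cmod z ^ n \<le> 1" using True by (intro power_le_one) auto
    then show ?thesis
      using kernel_factor_pos[OF w] monomial_norm_sq_pos[OF \<eta>, of n]
      by (simp add: norm_mult norm_divide norm_power mult_left_le divide_right_mono)
  qed
  have "cmod (normalized_kernel \<eta> w z) = cmod (\<Sum>n. ?t n)"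
    using sums_unique[OF normalized_kernel_sums[OF w True]] by simp
  also have "\<dots> \<le> (\<Sum>n. kernel_factor \<eta> w * (cmod w ^ n / monomial_norm_sq \<eta> n))"
    by (rule norm_suminf_le[OF le summ])
  also have "\<dots> = kernel_factor \<eta> w * kernel_majorant \<eta> (cmod w)"
    unfolding kernel_majorant_def using w by (intro suminf_mult summable_kernel_majorant) auto
  finally show ?thesis .
next
  case False
  then show ?thesis
    using kernel_factor_pos[OF w] kernel_majorant_nonneg[of "cmod w"] w
    by (simp add: normalized_kernel_def)
qed

lemma normalized_kernel_in_bergman_space:
  assumes w: "w \<in> unit_disk"
  shows "normalized_kernel \<eta> w \<in> bergman_space \<eta>"
  unfolding bergman_space_iff
proof (intro conjI allI impI)
  let ?B = "kernel_factor \<eta> w * kernel_majorant \<eta> (cmod w)"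
  show hol: "normalized_kernel \<eta> w holomorphic_on unit_disk"
    by (rule power_series_holomorphic[where
          a = "\<lambda>n. of_real (kernel_factor \<eta> w / monomial_norm_sq \<eta> n) * cnj w ^ n"])
      (use normalized_kernel_sums[OF w] in simp)
  show zero: "normalized_kernel \<eta> w z = 0" if "z \<notin> unit_disk" for z
    using that by (simp add: normalized_kernel_def)
  have [measurable]: "normalized_kernel \<eta> w \<in> borel_measurable borel"
    using hol zero by (rule measurable_if_holomorphic_on_disk)
  show "integrable (disk_area_weighted \<eta>) (\<lambda>z. (cmod (normalized_kernel \<eta> w z))\<^sup>2)"
  proof (rule integrable_if_bounded[OF \<eta>, of _ "?B\<^sup>2"])
    show "norm ((cmod (normalized_kernel \<eta> w z))\<^sup>2) \<le> ?B\<^sup>2" for z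
      using normalized_kernel_bound[OF w, of z] by (simp add: power_mono)
  qed measurable
qed

lemma bergman_norm_normalized_kernel_le:
  assumes w: "w \<in> unit_disk"
  shows "bergman_norm \<eta> (normalized_kernel \<eta> w) \<le> kernel_factor \<eta> w * kernel_majorant \<eta> (cmod w)"
proof -
  let ?B = "kernel_factor \<eta> w * kernel_majorant \<eta> (cmod w)"
  have [measurable]: "normalized_kernel \<eta> w \<in> borel_measurable borel"
    using normalized_kernel_in_bergman_space[OF w] by (rule bergman_measurable)
  have "(LINT z|disk_area_weighted \<eta>. norm ((cmod (normalized_kernel \<eta> w z))\<^sup>2)) \<le> ?B\<^sup>2"
    using normalized_kernel_bound[OF w]
    by (intro integral_norm_le[OF \<eta>]) (auto intro: power_mono)
  moreover have "0 \<le> ?B"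
    using order_trans[OF norm_ge_zero normalized_kernel_bound[OF w]] .
  ultimately show ?thesis by (simp add: bergman_norm_def real_le_lsqrt)
qed

text \<open>
  The reproducing property.  The kernel series may be integrated against \<open>f\<close> term by term because its
  terms are summable uniformly on the disk; each factor \<open>monomial_norm_sq\<close> from the
  Taylor coefficient cancels the denominator in the kernel.
\<close>

lemma bergman_inner_normalized_kernel:
  assumes f: "f \<in> bergman_space \<eta>" and w: "w \<in> unit_disk"
  shows "bergman_inner \<eta> f (normalized_kernel \<eta> w) = of_real (kernel_factor \<eta> w) * f w"
proof -
  define c where "c n = kernel_factor \<eta> w / monomial_norm_sq \<eta> n" for n
  define F where "F n z = of_real (c n) * w ^ n * (f z * cnj z ^ n)" for n z
  have c: "0 < c n" for n
    using kernel_factor_pos[OF w] monomial_norm_sq_pos[OF \<eta>] by (simp add: c_def)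
  have summ: "summable (\<lambda>n. c n * cmod w ^ n)"
    using summable_mult[OF summable_kernel_majorant[of "cmod w"], of "kernel_factor \<eta> w"] w
    by (simp add: c_def)
  have [measurable]: "f \<in> borel_measurable borel" using f by (rule bergman_measurable)
  have f0: "f z = 0" if "z \<notin> unit_disk" for z using f that by (simp add: bergman_space_iff)
  have F_meas [measurable]: "F n \<in> borel_measurable borel" for n
  proof -
    have [measurable]: "(\<lambda>z. cnj z ^ n) \<in> borel_measurable borel"
      by (intro borel_measurable_continuous_onI continuous_intros)
    show ?thesis unfolding F_def by measurable
  qed
  have F_le: "norm (F n z) \<le> c n * cmod w ^ n * cmod (f z)" for n z
  proof (cases "z \<in> unit_disk")
    case True
    then have "cmod z ^ n \<le> 1" by (intro power_le_one) auto
    then have "cmod (f z) * cmod z ^ n \<le> cmod (f z)" by (intro mult_left_le) auto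
    then show ?thesis using c[of n]
      by (simp add: F_def norm_mult norm_power mult_left_mono)
  qed (simp add: F_def f0)
  have f_int: "integrable (disk_area_weighted \<eta>) (\<lambda>z. cmod (f z))"
    using integrable_bergman[OF \<eta> f] by (rule integrable_norm)
  have F_int: "integrable (disk_area_weighted \<eta>) (F n)" for n
  proof (rule Bochner_Integration.integrable_bound)
    show "integrable (disk_area_weighted \<eta>) (\<lambda>z. c n * cmod w ^ n * cmod (f z))" using f_int by simp
    show "AE z in disk_area_weighted \<eta>. norm (F n z) \<le> norm (c n * cmod w ^ n * cmod (f z))"
      using F_le order_trans[OF _ abs_ge_self] by (intro AE_I2) auto
  qed measurable
  have "(\<lambda>n. LINT z|disk_area_weighted \<eta>. F n z) sums (LINT z|disk_area_weighted \<eta>. (\<Sum>n. F n z))"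
  proof (rule sums_integral[OF F_int])
    have summz: "summable (\<lambda>n. c n * cmod w ^ n * cmod (f z))" for z
      using summ by (rule summable_mult2)
    show "AE z in disk_area_weighted \<eta>. summable (\<lambda>n. norm (F n z))"
      by (intro AE_I2 summable_comparison_test'[OF summz, of 0]) (use F_le in simp)
    have "(LINT z|disk_area_weighted \<eta>. norm (F n z)) \<le> (LINT z|disk_area_weighted \<eta>. c n * cmod w ^ n * cmod (f z))" for n
      using f_int F_int F_le by (intro integral_mono integrable_norm) auto
    then have "norm (LINT z|disk_area_weighted \<eta>. norm (F n z)) \<le> c n * cmod w ^ n * (LINT z|disk_area_weighted \<eta>. cmod (f z))" for n
      by simp
    then show "summable (\<lambda>n. LINT z|disk_area_weighted \<eta>. norm (F n z))"
      by (intro summable_comparison_test'[OF summable_mult2[OF summ], of 0]) auto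
  qed
  moreover have "(\<Sum>n. F n z) = f z * cnj (normalized_kernel \<eta> w z)" for z
  proof (cases "z \<in> unit_disk")
    case True
    have "(\<lambda>n. cnj (of_real (c n) * cnj w ^ n * z ^ n)) sums cnj (normalized_kernel \<eta> w z)"
      using normalized_kernel_sums[OF w True] by (simp only: sums_cnj c_def)
    from sums_mult[OF this, of "f z"] have "(\<lambda>n. F n z) sums (f z * cnj (normalized_kernel \<eta> w z))"
      by (simp add: F_def mult_ac)
    then show ?thesis by (simp add: sums_iff)
  qed (simp add: F_def f0)
  moreover have "(LINT z|disk_area_weighted \<eta>. F n z) = of_real (kernel_factor \<eta> w) * ((deriv ^^ n) f 0 / fact n * w ^ n)" for n
  proof -
    have "(LINT z|disk_area_weighted \<eta>. F n z) = of_real (c n) * w ^ n * (LINT z|disk_area_weighted \<eta>. f z * cnj z ^ n)"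
      unfolding F_def by (rule integral_mult_right_zero)
    then show ?thesis
      using integral_bergman_monomial[OF \<eta> f, of n] monomial_norm_sq_pos[OF \<eta>, of n]
      by (simp add: c_def)
  qed
  ultimately have "(\<lambda>n. of_real (kernel_factor \<eta> w) * ((deriv ^^ n) f 0 / fact n * w ^ n))
      sums bergman_inner \<eta> f (normalized_kernel \<eta> w)"
    by (simp add: bergman_inner_def)
  moreover have "(\<lambda>n. of_real (kernel_factor \<eta> w) * ((deriv ^^ n) f 0 / fact n * w ^ n))
      sums (of_real (kernel_factor \<eta> w) * f w)"
  proof (rule sums_mult)
    have "f holomorphic_on unit_disk" using f by (simp add: bergman_space_iff)
    from holomorphic_power_series[OF this w]
    show "(\<lambda>n. (deriv ^^ n) f 0 / fact n * w ^ n) sums f w" by simp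
  qed
  ultimately show ?thesis by (rule sums_unique2)
qed

lemma bergman_point_evaluation_le:
  assumes f: "f \<in> bergman_space \<eta>" and z: "cmod z \<le> r" and r: "r < 1"
  shows "cmod (f z) \<le> kernel_majorant \<eta> r * bergman_norm \<eta> f"
proof -
  have zd: "z \<in> unit_disk" using z r by simp
  have nf: "0 \<le> bergman_norm \<eta> f" by (simp add: bergman_norm_def)
  have "kernel_factor \<eta> z * cmod (f z) = cmod (bergman_inner \<eta> f (normalized_kernel \<eta> z))"
    using bergman_inner_normalized_kernel[OF f zd] kernel_factor_pos[OF zd] by (simp add: norm_mult)
  also have "\<dots> \<le> bergman_norm \<eta> f * bergman_norm \<eta> (normalized_kernel \<eta> z)"
    using f normalized_kernel_in_bergman_space[OF zd] by (rule bergman_cauchy_schwarz)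
  also have "\<dots> \<le> bergman_norm \<eta> f * (kernel_factor \<eta> z * kernel_majorant \<eta> (cmod z))"
    using bergman_norm_normalized_kernel_le[OF zd] nf by (rule mult_left_mono)
  also have "\<dots> = kernel_factor \<eta> z * (kernel_majorant \<eta> (cmod z) * bergman_norm \<eta> f)" by simp
  finally have "cmod (f z) \<le> kernel_majorant \<eta> (cmod z) * bergman_norm \<eta> f"
    using kernel_factor_pos[OF zd] by (rule mult_left_le_imp_le)
  also have "\<dots> \<le> kernel_majorant \<eta> r * bergman_norm \<eta> f"
    using kernel_majorant_mono[of "cmod z" r] z r nf by (intro mult_right_mono) auto
  finally show ?thesis .
qed

text \<open>
  Point evaluations are bounded uniformly on compact subsets, so a Cauchy sequence is locally
  uniformly Cauchy and has a holomorphic limit \<open>g\<close>.  Fatou's lemma, applied to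
  \<open>(cmod (X m z - X n z))\<^sup>2\<close> as \<open>n\<close> tends to infinity, bounds the distance from \<open>X m\<close> to \<open>g\<close>.
\<close>

lemma bergman_space_complete:
  assumes X: "\<And>n. X n \<in> bergman_space \<eta>"
    and cauchy: "\<And>e. 0 < e \<Longrightarrow> \<exists>M. \<forall>m\<ge>M. \<forall>n\<ge>M. bergman_norm \<eta> (\<lambda>z. X m z - X n z) < e"
  shows "\<exists>g\<in>bergman_space \<eta>. (\<lambda>n. bergman_norm \<eta> (\<lambda>z. X n z - g z)) \<longlonglongrightarrow> 0"
proof -
  have uniform_cauchy: "\<exists>M. \<forall>m\<ge>M. \<forall>n\<ge>M. \<forall>z\<in>cball 0 r. cmod (X m z - X n z) < e"
    if r: "0 \<le> r" "r < 1" and e: "0 < e" for r e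
  proof -
    define D where "D = kernel_majorant \<eta> r + 1"
    have D: "0 < D" using kernel_majorant_nonneg[OF r] by (simp add: D_def)
    obtain M where M: "\<And>m n. m \<ge> M \<Longrightarrow> n \<ge> M \<Longrightarrow> bergman_norm \<eta> (\<lambda>z. X m z - X n z) < e / D"
      using cauchy[of "e / D"] e D by auto
    have "cmod (X m z - X n z) < e" if mn: "m \<ge> M" "n \<ge> M" and z: "z \<in> cball 0 r" for m n z
    proof -
      have "cmod (X m z - X n z) \<le> kernel_majorant \<eta> r * bergman_norm \<eta> (\<lambda>z. X m z - X n z)"
        using bergman_point_evaluation_le[OF bergman_space_diff[OF X X], of z r] z r by simp
      also have "\<dots> \<le> D * bergman_norm \<eta> (\<lambda>z. X m z - X n z)"
        by (intro mult_right_mono) (simp_all add: D_def bergman_norm_def)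
      also have "\<dots> < D * (e / D)" using M[OF mn] D by (rule mult_strict_left_mono)
      finally show ?thesis using D by simp
    qed
    then show ?thesis by blast
  qed
  define g where "g z = (if z \<in> unit_disk then lim (\<lambda>n. X n z) else 0)" for z
  have X0: "X n z = 0" if "z \<notin> unit_disk" for n z using X[of n] that by (simp add: bergman_space_iff)
  have lim: "(\<lambda>n. X n z) \<longlonglongrightarrow> g z" for z
  proof (cases "z \<in> unit_disk")
    case True
    have "Cauchy (\<lambda>n. X n z)"
    proof (rule CauchyI)
      fix e :: real assume "0 < e"
      then obtain M where "\<forall>m\<ge>M. \<forall>n\<ge>M. \<forall>z'\<in>cball 0 (cmod z). cmod (X m z' - X n z') < e"
        using uniform_cauchy[of "cmod z" e] True by auto
      then show "\<exists>M. \<forall>m\<ge>M. \<forall>n\<ge>M. norm (X m z - X n z) < e"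
        by (intro exI[of _ M]) simp
    qed
    then have "convergent (\<lambda>n. X n z)" by (simp add: Cauchy_convergent_iff)
    then show ?thesis using True by (simp add: g_def convergent_LIMSEQ_iff)
  qed (simp add: g_def X0)
  have hol: "g holomorphic_on unit_disk"
  proof (rule holomorphic_uniform_sequence[of _ X])
    show "X n holomorphic_on unit_disk" for n using X[of n] by (simp add: bergman_space_iff)
    fix x :: complex assume "x \<in> unit_disk"
    then have x: "cmod x < 1" by simp
    define d where "d = (1 - cmod x) / 2"
    define r where "r = (1 + cmod x) / 2"
    have dr: "0 < d" "0 \<le> r" "r < 1" "cmod x + d = r" using x by (auto simp: d_def r_def field_simps)
    have sub: "cball x d \<subseteq> cball 0 r"
      using dr by (simp add: cball_subset_cball_iff)
    have "uniform_limit (cball x d) X g sequentially"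
    proof (rule uniform_limitI)
      fix e :: real assume e: "0 < e"
      obtain M where M: "\<forall>m\<ge>M. \<forall>n\<ge>M. \<forall>z\<in>cball 0 r. cmod (X m z - X n z) < e / 2"
        using uniform_cauchy[OF dr(2,3), of "e / 2"] e by auto
      have "dist (X m z) (g z) < e" if "m \<ge> M" "z \<in> cball x d" for m z
      proof -
        have "cmod (X m z - g z) \<le> e / 2"
        proof (rule LIMSEQ_le_const2)
          show "(\<lambda>n. cmod (X m z - X n z)) \<longlonglongrightarrow> cmod (X m z - g z)"
            using lim[of z] by (intro tendsto_intros)
          have "z \<in> cball 0 r" using that(2) sub by blast
          then show "\<exists>N. \<forall>n\<ge>N. cmod (X m z - X n z) \<le> e / 2"
            using M that(1) by (meson less_imp_le)
        qed
        then show ?thesis using e by (simp add: dist_norm)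
      qed
      then show "\<forall>\<^sub>F m in sequentially. \<forall>z\<in>cball x d. dist (X m z) (g z) < e"
        unfolding eventually_sequentially by blast
    qed
    moreover have "cball x d \<subseteq> unit_disk"
    proof
      fix z assume "z \<in> cball x d"
      then show "z \<in> unit_disk" using sub dr(3) by auto
    qed
    ultimately show "\<exists>d>0. cball x d \<subseteq> unit_disk \<and> uniform_limit (cball x d) X g sequentially"
      using dr(1) by blast
  qed simp
  have g0: "g z = 0" if "z \<notin> unit_disk" for z using that by (simp add: g_def)
  have [measurable]: "X n \<in> borel_measurable borel" for n using X by (rule bergman_measurable)
  have [measurable]: "g \<in> borel_measurable borel"
    using hol g0 by (rule measurable_if_holomorphic_on_disk)
  have close: "\<exists>M. \<forall>m\<ge>M. (\<lambda>z. X m z - g z) \<in> bergman_space \<eta> \<and> bergman_norm \<eta> (\<lambda>z. X m z - g z) \<le> e"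
    if e: "0 < e" for e
  proof -
    obtain M where M: "\<And>m n. m \<ge> M \<Longrightarrow> n \<ge> M \<Longrightarrow> bergman_norm \<eta> (\<lambda>z. X m z - X n z) < e"
      using cauchy[OF e] by blast
    have "(\<lambda>z. X m z - g z) \<in> bergman_space \<eta> \<and> bergman_norm \<eta> (\<lambda>z. X m z - g z) \<le> e"
      if m: "m \<ge> M" for m
    proof -
      have "(\<integral>\<^sup>+z. ennreal ((cmod (X m z - g z))\<^sup>2) \<partial>disk_area_weighted \<eta>)
          = (\<integral>\<^sup>+z. liminf (\<lambda>n. ennreal ((cmod (X m z - X n z))\<^sup>2)) \<partial>disk_area_weighted \<eta>)"
      proof (rule nn_integral_cong)
        fix z
        have "(\<lambda>n. ennreal ((cmod (X m z - X n z))\<^sup>2)) \<longlonglongrightarrow> ennreal ((cmod (X m z - g z))\<^sup>2)"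
          using lim[of z] by (intro tendsto_ennrealI tendsto_intros)
        from lim_imp_Liminf[OF _ this]
        show "ennreal ((cmod (X m z - g z))\<^sup>2) = liminf (\<lambda>n. ennreal ((cmod (X m z - X n z))\<^sup>2))"
          by simp
      qed
      also have "\<dots> \<le> liminf (\<lambda>n. \<integral>\<^sup>+z. ennreal ((cmod (X m z - X n z))\<^sup>2) \<partial>disk_area_weighted \<eta>)"
        by (rule nn_integral_liminf) measurable
      also have "\<dots> \<le> ennreal (e\<^sup>2)"
      proof (rule Liminf_le)
        have "(\<integral>\<^sup>+z. ennreal ((cmod (X m z - X n z))\<^sup>2) \<partial>disk_area_weighted \<eta>) \<le> ennreal (e\<^sup>2)" if n: "n \<ge> M" for n
        proof -
          have "integrable (disk_area_weighted \<eta>) (\<lambda>z. (cmod (X m z - X n z))\<^sup>2)"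
            using bergman_space_diff[OF X X, of m n] by (simp add: bergman_space_iff)
          then have "(\<integral>\<^sup>+z. ennreal ((cmod (X m z - X n z))\<^sup>2) \<partial>disk_area_weighted \<eta>)
              = ennreal (LINT z|disk_area_weighted \<eta>. (cmod (X m z - X n z))\<^sup>2)"
            by (rule nn_integral_eq_integral) simp
          also have "(LINT z|disk_area_weighted \<eta>. (cmod (X m z - X n z))\<^sup>2) = (bergman_norm \<eta> (\<lambda>z. X m z - X n z))\<^sup>2"
            by (simp add: bergman_norm_def)
          also have "ennreal \<dots> \<le> ennreal (e\<^sup>2)"
            using M[OF m n] by (intro ennreal_leI power_mono) (auto simp: bergman_norm_def)
          finally show ?thesis .
        qed
        then show "\<forall>\<^sub>F n in sequentially. (\<integral>\<^sup>+z. ennreal ((cmod (X m z - X n z))\<^sup>2) \<partial>disk_area_weighted \<eta>) \<le> ennreal (e\<^sup>2)"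
          unfolding eventually_sequentially by blast
      qed simp
      finally have fatou: "(\<integral>\<^sup>+z. ennreal ((cmod (X m z - g z))\<^sup>2) \<partial>disk_area_weighted \<eta>) \<le> ennreal (e\<^sup>2)" .
      have int: "integrable (disk_area_weighted \<eta>) (\<lambda>z. (cmod (X m z - g z))\<^sup>2)"
      proof (rule integrableI_bounded)
        show "(\<integral>\<^sup>+z. ennreal (norm ((cmod (X m z - g z))\<^sup>2)) \<partial>disk_area_weighted \<eta>) < \<infinity>"
          using le_less_trans[OF fatou] by simp
      qed measurable
      have "ennreal (LINT z|disk_area_weighted \<eta>. (cmod (X m z - g z))\<^sup>2) \<le> ennreal (e\<^sup>2)"
        using fatou nn_integral_eq_integral[OF int] by simp
      then have "(LINT z|disk_area_weighted \<eta>. (cmod (X m z - g z))\<^sup>2) \<le> e\<^sup>2"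
        by (simp add: ennreal_le_iff)
      then have "bergman_norm \<eta> (\<lambda>z. X m z - g z) \<le> e"
        using e by (simp add: bergman_norm_def real_le_lsqrt)
      moreover have "(\<lambda>z. X m z - g z) \<in> bergman_space \<eta>"
        using X[of m] hol g0 int by (auto simp: bergman_space_iff intro: holomorphic_on_diff)
      ultimately show ?thesis by blast
    qed
    then show ?thesis by blast
  qed
  obtain M where "(\<lambda>z. X M z - g z) \<in> bergman_space \<eta>" using close[of 1] by auto
  from bergman_space_diff[OF X[of M] this] have "g \<in> bergman_space \<eta>" by simp
  moreover have "(\<lambda>n. bergman_norm \<eta> (\<lambda>z. X n z - g z)) \<longlonglongrightarrow> 0"
  proof (rule LIMSEQ_I)
    fix e :: real assume "0 < e"
    then obtain M where "\<forall>m\<ge>M. bergman_norm \<eta> (\<lambda>z. X m z - g z) \<le> e / 2"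
      using close[of "e / 2"] by auto
    then have "norm (bergman_norm \<eta> (\<lambda>z. X m z - g z) - 0) < e" if "m \<ge> M" for m
      using that \<open>0 < e\<close> by (fastforce simp: bergman_norm_def)
    then show "\<exists>M. \<forall>m\<ge>M. norm (bergman_norm \<eta> (\<lambda>z. X m z - g z) - 0) < e" by blast
  qed
  ultimately show ?thesis by blast
qed

lemma hilbert_space_bergman:
  "hilbert_space (\<lambda>c f z. c * f z) (bergman_space \<eta>) (bergman_inner \<eta>)"
proof (intro hilbert_space.intro semi_inner_space_bergman hilbert_space_axioms.intro)
  interpret semi_inner_space "\<lambda>c f z. c * f z" "bergman_space \<eta>" "bergman_inner \<eta>"
    by (rule semi_inner_space_bergman)
  have nrm: "nrm f = bergman_norm \<eta> f" for f by (simp add: nrm_def bergman_norm_eq)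
  fix f assume f: "f \<in> bergman_space \<eta>" "nrm f = 0"
  show "f = 0"
  proof
    fix z
    show "f z = 0 z"
    proof (cases "z \<in> unit_disk")
      case True
      then have "cmod (f z) \<le> kernel_majorant \<eta> (cmod z) * bergman_norm \<eta> f"
        using f(1) by (intro bergman_point_evaluation_le) auto
      then show ?thesis using f(2) by (simp add: nrm)
    qed (use f in \<open>simp add: bergman_space_iff\<close>)
  qed
next
  interpret semi_inner_space "\<lambda>c f z. c * f z" "bergman_space \<eta>" "bergman_inner \<eta>"
    by (rule semi_inner_space_bergman)
  have nrm: "nrm f = bergman_norm \<eta> f" for f by (simp add: nrm_def bergman_norm_eq)
  have minus: "f - g = (\<lambda>z. f z - g z)" for f g :: "complex \<Rightarrow> complex" by (simp add: fun_eq_iff)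
  fix X :: "nat \<Rightarrow> complex \<Rightarrow> complex"
  assume "\<And>n. X n \<in> bergman_space \<eta>"
    and "\<And>e. 0 < e \<Longrightarrow> \<exists>M. \<forall>m\<ge>M. \<forall>n\<ge>M. nrm (X m - X n) < e"
  then show "\<exists>x\<in>bergman_space \<eta>. converges_to X x"
    unfolding converges_to_def nrm minus by (rule bergman_space_complete)
qed

end

section \<open>Atomic systems of normalized reproducing kernels\<close>

lemma sum_fun_apply: "(\<Sum>i\<in>I. u i) z = (\<Sum>i\<in>I. u i z)"
  for u :: "'i \<Rightarrow> 'a \<Rightarrow> 'b::comm_monoid_add"
  by (induction I rule: infinite_finite_induct) auto

theorem corollary6:
  fixes \<eta> :: real
    and L :: "(complex \<Rightarrow> complex) \<Rightarrow> (complex \<Rightarrow> complex)"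
    and w :: "nat \<Rightarrow> complex"
  assumes "\<eta> > -1"
    and "bounded_operator \<eta> L"
    and "\<And>n. w n \<in> unit_disk"
    and "inj w"
  defines "k \<equiv> \<lambda>n. normalized_kernel \<eta> (w n)"
  defines "i \<equiv> atomic_system \<eta> L k"
    and "ii \<equiv> sampling_sequence \<eta> L w"
    and "iii \<equiv> bessel_sequence \<eta> k \<and>
           (\<exists>g. bessel_sequence \<eta> g \<and>
              (\<forall>f\<in>bergman_space \<eta>.
                 bergman_sums \<eta> (\<lambda>n z. bergman_inner \<eta> f (g n) * k n z) (L f)))"
    and "iv \<equiv> (\<forall>f\<in>bergman_space \<eta>.
              summable (\<lambda>n. (1 - (cmod (w n))\<^sup>2) powr (2 + \<eta>) * (cmod (f (w n)))\<^sup>2)) \<and>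
           (\<exists>g. bessel_sequence \<eta> g \<and>
              (\<forall>f\<in>bergman_space \<eta>.
                 bergman_sums \<eta>
                   (\<lambda>n z. complex_of_real ((1 - (cmod (w n))\<^sup>2) powr (1 + \<eta> / 2)) * f (w n) * g n z)
                   (bergman_adjoint \<eta> L f)))"
  shows "(i \<longleftrightarrow> ii) \<and> (ii \<longleftrightarrow> iii) \<and> (iii \<longleftrightarrow> iv)"
proof -
  interpret hilbert_space "\<lambda>c f z. c * f z" "bergman_space \<eta>" "bergman_inner \<eta>"
    using assms(1) by (rule hilbert_space_bergman)
  have nrm: "nrm = bergman_norm \<eta>" by (simp add: nrm_def bergman_norm_eq fun_eq_iff)
  have plus: "f + g = (\<lambda>z. f z + g z)" for f g :: "complex \<Rightarrow> complex" by (simp add: fun_eq_iff)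
  have op: "bounded_op L"
    using assms(2) by (simp add: bounded_op_def bounded_operator_def nrm plus)
  have adj: "bergman_adjoint \<eta> L = adj L"
    by (simp add: adj_def bergman_adjoint_def fun_eq_iff)
  have bes: "bessel_sequence \<eta> u \<longleftrightarrow> bessel u" for u
    by (simp add: bessel_def bessel_sequence_def nrm)
  have kH: "k n \<in> bergman_space \<eta>" for n
    unfolding k_def using assms(1,3) by (rule normalized_kernel_in_bergman_space)
  have LH: "L f \<in> bergman_space \<eta>" if "f \<in> bergman_space \<eta>" for f
    using op that by (simp add: bounded_op_def)
  have sums: "bergman_sums \<eta> (\<lambda>n z. c n * u n z) h \<longleftrightarrow> h \<in> bergman_space \<eta> \<and> series_to c u h"
    if "\<And>n. u n \<in> bergman_space \<eta>" for c u h
  proof -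
    have "(\<Sum>n<N. (\<lambda>z. c n * u n z)) - h = (\<lambda>z. (\<Sum>n<N. c n * u n z) - h z)" for N
      by (simp add: fun_eq_iff sum_fun_apply)
    then show ?thesis
      using that by (simp add: bergman_sums_def series_to_def converges_to_def nrm bergman_space_scale)
  qed
  have eval: "bergman_inner \<eta> f (k n) = of_real ((1 - (cmod (w n))\<^sup>2) powr (1 + \<eta> / 2)) * f (w n)"
    if "f \<in> bergman_space \<eta>" for f n
    unfolding k_def using bergman_inner_normalized_kernel[OF assms(1) that assms(3)]
    by (simp add: kernel_factor_def)
  have eval_sq: "(cmod (bergman_inner \<eta> f (k n)))\<^sup>2 = (1 - (cmod (w n))\<^sup>2) powr (2 + \<eta>) * (cmod (f (w n)))\<^sup>2"
    if "f \<in> bergman_space \<eta>" for f n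
  proof -
    have "((1 - (cmod (w n))\<^sup>2) powr (1 + \<eta> / 2))\<^sup>2 = (1 - (cmod (w n))\<^sup>2) powr (2 + \<eta>)"
      by (simp add: power2_eq_square powr_add[symmetric])
    then show ?thesis using eval[OF that] by (simp add: norm_mult power_mult_distrib)
  qed
  have i: "i \<longleftrightarrow> (\<forall>c. in_l2 c \<longrightarrow> (\<exists>h\<in>bergman_space \<eta>. series_to c k h)) \<and>
      (\<exists>C>0. \<forall>f\<in>bergman_space \<eta>. \<exists>a. in_l2 a \<and> l2_norm a \<le> C * nrm f \<and> series_to a k (L f))"
    unfolding i_def atomic_system_def sums[OF kH] nrm using LH by (simp add: Bex_def cong: conj_cong)
  have ii: "ii \<longleftrightarrow> (\<exists>A>0. \<exists>B>0. \<forall>f\<in>bergman_space \<eta>.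
      summable (\<lambda>n. (cmod (bergman_inner \<eta> f (k n)))\<^sup>2) \<and>
      A * (nrm (adj L f))\<^sup>2 \<le> (\<Sum>n. (cmod (bergman_inner \<eta> f (k n)))\<^sup>2) \<and>
      (\<Sum>n. (cmod (bergman_inner \<eta> f (k n)))\<^sup>2) \<le> B * (nrm f)\<^sup>2)"
    unfolding ii_def sampling_sequence_def nrm adj by (simp add: eval_sq mult.commute cong: ball_cong)
  have iii: "iii \<longleftrightarrow> bessel k \<and> (\<exists>g. bessel g \<and>
      (\<forall>f\<in>bergman_space \<eta>. series_to (\<lambda>n. bergman_inner \<eta> f (g n)) k (L f)))"
    unfolding iii_def bes sums[OF kH] using LH by (simp cong: ball_cong)
  have iv: "iv \<longleftrightarrow> (\<forall>f\<in>bergman_space \<eta>. summable (\<lambda>n. (cmod (bergman_inner \<eta> f (k n)))\<^sup>2)) \<and>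
      (\<exists>g. bessel g \<and> (\<forall>f\<in>bergman_space \<eta>.
        series_to (\<lambda>n. bergman_inner \<eta> f (k n)) g (adj L f)))"
  proof -
    have "bergman_sums \<eta> (\<lambda>n z. of_real ((1 - (cmod (w n))\<^sup>2) powr (1 + \<eta> / 2)) * f (w n) * g n z)
          (adj L f) \<longleftrightarrow> series_to (\<lambda>n. bergman_inner \<eta> f (k n)) g (adj L f)"
      if "bessel g" "f \<in> bergman_space \<eta>" for g f
      using sums[of g "\<lambda>n. bergman_inner \<eta> f (k n)" "adj L f"] bessel_H[OF that(1)]
        adj_H[OF op that(2)] that(2) by (simp add: eval)
    then show ?thesis
      unfolding iv_def bes adj by (simp add: eval_sq cong: ball_cong conj_cong)
  qed
  show ?thesis
    unfolding i ii iii iv using kH op by (rule atomic_system_characterizations)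
qed

end
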